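(* Let $0<\alpha<2$ and $0<H<1$, and let $$Y(t)=\int_{\Omega'}\int_{\mathbb{R}} l(x,t)(\omega')\,M(d\omega',dx),\qquad t\ge 0,$$ where $l$ is the jointly continuous local time of a fractional Brownian motion with exponent of self-similarity $H$ defined on a probability space $(\Omega',\mathcal{F}',\mathbf{P}')$, and $M$ is a symmetric $\alpha$-stable random measure on $\Omega'\times\mathbb{R}$ with control measure $\mathbf{P}'\times\mathrm{Leb}$. Then $(Y(t),t\ge 0)$ is a well-defined symmetric $\alpha$-stable process (that is, $l(\cdot,t)(\cdot)\in L^\alpha(\mathbf{P}'\times\mathrm{Leb})$ for every $t\ge 0$). It has stationary increments and is self-similar, with exponent of self-similarity $$H'=1-H+\frac{H}{\alpha}=1+H\left(\frac1\alpha-1\right).$$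
   Context: A fractional Brownian motion $(B_H(t),t\ge0)$ with exponent $0<H<1$ is the continuous zero-mean Gaussian process with covariance $\mathrm{Cov}(B_H(s),B_H(t))=\frac{\mathbf{E}'B_H(1)^2}{2}\left[t^{2H}+s^{2H}-|t-s|^{2H}\right]$, with $\mathbf{E}'B_H(1)^2>0$. It lives on a probability space $(\Omega',\mathcal{F}',\mathbf{P}')$ and has a local time process $l=l(x,t)=l(x,t)(\omega')$, $x\in\mathbb{R}$, $t\ge0$, jointly continuous in $(x,t)$; local time means $\int_0^t g(B_H(s))\,ds=\int_{\mathbb{R}}g(x)l(x,t)\,dx$ for all nonnegative measurable $g$. $\mathrm{Leb}$ is Lebesgue measure on $\mathbb{R}$. A symmetric $\alpha$-stable (S$\alpha$S) random measure $M$ on a measurable space $(E,\mathcal{E})$ with $\sigma$-finite control measure $m$ is an independently scattered random measure, defined on a probability space $(\Omega,\mathcal{F},\mathbf{P})$ (here different from $\Omega'$), whose stochastic integrals $\int_E f\,dM$ are defined for $f\in L^\alpha(E,m)$, are linear in $f$, and satisfy $\mathbf{E}\exp\left(i\theta\int_E f\,dM\right)=\exp\left(-|\theta|^\alpha\int_E|f|^\alpha\,dm\right)$, $\theta\in\mathbb{R}$. A process is S$\alpha$S if all finite linear combinations of its values are S$\alpha$S random variables. A process $(Y(t),t\ge0)$ is self-similar with exponent $H'$ if for all $c>0$ the processes $(Y(ct),t\ge0)$ and $(c^{H'}Y(t),t\ge0)$ have the same finite-dimensional distributions. It has stationary increments if the finite-dimensional distributions of $(Y(t+a)-Y(a),t\ge0)$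 do not depend on $a\ge0$. *)

theory Defs
  imports "HOL-Probability.Probability"
begin

text \<open>Processes with time parameter in \<open>[0, \<infinity>)\<close> are functions \<open>X :: real \<Rightarrow> 'a \<Rightarrow> real\<close> of which only
  the values at times \<open>t \<ge> 0\<close> matter.\<close>

definition covariance :: "'a measure \<Rightarrow> ('a \<Rightarrow> real) \<Rightarrow> ('a \<Rightarrow> real) \<Rightarrow> real" where
  "covariance P X Y =
     (\<integral>\<omega>. (X \<omega> - (\<integral>\<omega>'. X \<omega>' \<partial>P)) * (Y \<omega> - (\<integral>\<omega>'. Y \<omega>' \<partial>P)) \<partial>P)"

text \<open>The law of \<open>\<mu> + \<sigma> Z\<close> with \<open>Z\<close> standard normal; \<open>\<sigma> = 0\<close> gives the degenerate normal laws.\<close>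

definition gaussian_rv :: "'a measure \<Rightarrow> ('a \<Rightarrow> real) \<Rightarrow> bool" where
  "gaussian_rv P X \<longleftrightarrow> X \<in> borel_measurable P \<and>
     (\<exists>\<mu> \<sigma>. distr P borel X = distr std_normal_distribution borel (\<lambda>z. \<mu> + \<sigma> * z))"

definition gaussian_process :: "'a measure \<Rightarrow> (real \<Rightarrow> 'a \<Rightarrow> real) \<Rightarrow> bool" where
  "gaussian_process P X \<longleftrightarrow>
     (\<forall>J c. finite J \<longrightarrow> J \<subseteq> {0..} \<longrightarrow> gaussian_rv P (\<lambda>\<omega>. \<Sum>t\<in>J. c t * X t \<omega>))"

locale fractional_Brownian_motion = prob_space P for P :: "'a measure" +
  fixes H :: real and B :: "real \<Rightarrow> 'a \<Rightarrow> real"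
  assumes H_pos: "0 < H" and H_less_1: "H < 1"
    and gaussian: "gaussian_process P B"
    and mean_zero: "\<And>t. 0 \<le> t \<Longrightarrow> expectation (B t) = 0"
    and variance_pos: "0 < expectation (\<lambda>\<omega>. (B 1 \<omega>)\<^sup>2)"
    and covariance: "\<And>s t. 0 \<le> s \<Longrightarrow> 0 \<le> t \<Longrightarrow>
      covariance P (B s) (B t) = expectation (\<lambda>\<omega>. (B 1 \<omega>)\<^sup>2) / 2 *
        (t powr (2 * H) + s powr (2 * H) - \<bar>t - s\<bar> powr (2 * H))"
    and continuous_paths: "\<And>\<omega>. \<omega> \<in> space P \<Longrightarrow> continuous_on {0..} (\<lambda>t. B t \<omega>)"

text \<open>The occupation time formula is required outside one null set, simultaneously for all \<open>t\<close>
  and \<open>g\<close>. Nonnegativity has to be stated since \<open>ennreal\<close> truncates negative reals to \<open>0\<close>.\<close>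

locale jointly_continuous_local_time =
  fixes P :: "'a measure" and X :: "real \<Rightarrow> 'a \<Rightarrow> real" and l :: "real \<Rightarrow> real \<Rightarrow> 'a \<Rightarrow> real"
  assumes measurable: "\<And>x t. 0 \<le> t \<Longrightarrow> l x t \<in> borel_measurable P"
    and jointly_continuous:
      "\<And>\<omega>. \<omega> \<in> space P \<Longrightarrow> continuous_on (UNIV \<times> {0..}) (\<lambda>(x, t). l x t \<omega>)"
    and nonneg: "AE \<omega> in P. \<forall>x. \<forall>t\<ge>0. 0 \<le> l x t \<omega>"
    and occupation: "AE \<omega> in P. \<forall>t\<ge>0. \<forall>g :: real \<Rightarrow> ennreal. g \<in> borel_measurable borel \<longrightarrow>
      (\<integral>\<^sup>+s\<in>{0..t}. g (X s \<omega>) \<partial>lborel) = (\<integral>\<^sup>+x. g x * ennreal (l x t \<omega>) \<partial>lborel)"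

definition L_space :: "real \<Rightarrow> 'e measure \<Rightarrow> ('e \<Rightarrow> real) set" where
  "L_space \<alpha> m = {f \<in> borel_measurable m. integrable m (\<lambda>x. \<bar>f x\<bar> powr \<alpha>)}"

text \<open>\<open>M\<close> is the random measure on the measurable sets of finite control measure, and \<open>I f\<close> is a
  version of the stochastic integral \<open>\<integral> f dM\<close>. No condition is put on \<open>I f\<close> for \<open>f\<close> outside
  \<open>L_space \<alpha> m\<close>, so integrability of an integrand is never implicit in writing \<open>I f\<close>.\<close>

locale SaS_random_measure =
  prob_space P + control: sigma_finite_measure m
  for P :: "'v measure" and m :: "'e measure" +
  fixes \<alpha> :: real and M :: "'e set \<Rightarrow> 'v \<Rightarrow> real" and I :: "('e \<Rightarrow> real) \<Rightarrow> 'v \<Rightarrow> real"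
  assumes M_measurable: "\<And>A. A \<in> sets m \<Longrightarrow> emeasure m A < \<infinity> \<Longrightarrow> M A \<in> borel_measurable P"
    and independently_scattered: "\<And>A :: nat \<Rightarrow> 'e set.
      (\<And>n. A n \<in> sets m) \<Longrightarrow> (\<And>n. emeasure m (A n) < \<infinity>) \<Longrightarrow> disjoint_family A \<Longrightarrow>
      indep_vars (\<lambda>_. borel) (\<lambda>n. M (A n)) UNIV"
    and countably_additive: "\<And>A :: nat \<Rightarrow> 'e set.
      (\<And>n. A n \<in> sets m) \<Longrightarrow> emeasure m (\<Union>n. A n) < \<infinity> \<Longrightarrow> disjoint_family A \<Longrightarrow>
      AE \<omega> in P. (\<lambda>n. M (A n) \<omega>) sums M (\<Union>n. A n) \<omega>"
    and integral_measurable: "\<And>f. f \<in> L_space \<alpha> m \<Longrightarrow> I f \<in> borel_measurable P"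
    and integral_indicator: "\<And>A. A \<in> sets m \<Longrightarrow> emeasure m A < \<infinity> \<Longrightarrow>
      AE \<omega> in P. I (indicator A) \<omega> = M A \<omega>"
    and integral_linear: "\<And>f g a b. f \<in> L_space \<alpha> m \<Longrightarrow> g \<in> L_space \<alpha> m \<Longrightarrow>
      AE \<omega> in P. I (\<lambda>x. a * f x + b * g x) \<omega> = a * I f \<omega> + b * I g \<omega>"
    and integral_char: "\<And>f \<theta>. f \<in> L_space \<alpha> m \<Longrightarrow>
      char (distr P borel (I f)) \<theta> =
        complex_of_real (exp (- (\<bar>\<theta>\<bar> powr \<alpha> * (\<integral>x. \<bar>f x\<bar> powr \<alpha> \<partial>m))))"

definition SaS_rv :: "'a measure \<Rightarrow> real \<Rightarrow> ('a \<Rightarrow> real) \<Rightarrow> bool" where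
  "SaS_rv P \<alpha> X \<longleftrightarrow> X \<in> borel_measurable P \<and>
     (\<exists>\<sigma>\<ge>0. \<forall>\<theta>. char (distr P borel X) \<theta> =
        complex_of_real (exp (- (\<sigma> powr \<alpha> * \<bar>\<theta>\<bar> powr \<alpha>))))"

definition SaS_process :: "'a measure \<Rightarrow> real \<Rightarrow> (real \<Rightarrow> 'a \<Rightarrow> real) \<Rightarrow> bool" where
  "SaS_process P \<alpha> X \<longleftrightarrow>
     (\<forall>J c. finite J \<longrightarrow> J \<subseteq> {0..} \<longrightarrow> SaS_rv P \<alpha> (\<lambda>\<omega>. \<Sum>t\<in>J. c t * X t \<omega>))"

definition same_fdd :: "'a measure \<Rightarrow> (real \<Rightarrow> 'a \<Rightarrow> real) \<Rightarrow> (real \<Rightarrow> 'a \<Rightarrow> real) \<Rightarrow> bool" where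
  "same_fdd P X Y \<longleftrightarrow> (\<forall>J. finite J \<longrightarrow> J \<subseteq> {0..} \<longrightarrow>
     distr P (Pi\<^sub>M J (\<lambda>_. borel)) (\<lambda>\<omega>. \<lambda>t\<in>J. X t \<omega>) =
     distr P (Pi\<^sub>M J (\<lambda>_. borel)) (\<lambda>\<omega>. \<lambda>t\<in>J. Y t \<omega>))"

definition self_similar :: "'a measure \<Rightarrow> real \<Rightarrow> (real \<Rightarrow> 'a \<Rightarrow> real) \<Rightarrow> bool" where
  "self_similar P h Y \<longleftrightarrow>
     (\<forall>c>0. same_fdd P (\<lambda>t. Y (c * t)) (\<lambda>t \<omega>. c powr h * Y t \<omega>))"

definition stationary_increments :: "'a measure \<Rightarrow> (real \<Rightarrow> 'a \<Rightarrow> real) \<Rightarrow> bool" where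
  "stationary_increments P Y \<longleftrightarrow>
     (\<forall>a\<ge>0. \<forall>b\<ge>0. same_fdd P (\<lambda>t \<omega>. Y (t + a) \<omega> - Y a \<omega>) (\<lambda>t \<omega>. Y (t + b) \<omega> - Y b \<omega>))"

end

theory Submission
  imports Defs
begin

text \<open>
  A finite combination \<open>\<Sum> c\<^sub>t Y(t)\<close> is the stochastic integral of \<open>\<Sum> c\<^sub>t l(x,t)\<close>, hence it is
  symmetric stable, and the \<open>\<alpha>\<close>-th power of its scale is \<open>\<integral>\<integral> \<bar>\<Sum> c\<^sub>t l(x,t)\<bar>\<^sup>\<alpha> dx dP'\<close>. By the
  Cramer--Wold device (\<open>same_fddI_char\<close>) these double integrals determine the finite-dimensional
  distributions of \<open>Y\<close>, so both invariances of \<open>Y\<close> reduce to identities between such double integrals.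

  The identities come from the invariances of fractional Brownian motion: the processes
  \<open>B(t+a) - B(a)\<close> and \<open>c\<^sup>-\<^sup>H B(ct)\<close> have the law of \<open>B\<close> (\<open>increments_same_fdd\<close>,
  \<open>rescaled_same_fdd\<close>), and their local times are \<open>l(x+B(a),t+a) - l(x+B(a),a)\<close> and
  \<open>c\<^sup>H\<^sup>-\<^sup>1 l(c\<^sup>H x,ct)\<close>. A local time is an almost sure limit of averages of the path, so the law of a
  combination of local times at a fixed level depends only on the finite-dimensional distributions
  of the process (\<open>local_time_law_cong\<close>). Integrating over the level, the random translation by \<open>B(a)\<close>
  disappears because Lebesgue measure is translation invariant (\<open>moment_increments\<close>). Under
  rescaling, the substitution in the level contributes \<open>c\<^sup>H\<close> and the prefactor of the local time
  contributes \<open>c\<close> to the power \<open>(1-H)\<alpha>\<close> (\<open>moment_rescaled\<close>), and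
  \<open>H + (1-H)\<alpha>\<close> is \<open>\<alpha>\<close> times the claimed exponent.

  Finiteness of the double integrals (\<open>local_time_in_L_space\<close>) is a question about small and
  large values of the local time. Large values are controlled by its square, whose expected integral over the levels
  is at most a multiple of \<open>\<integral>\<integral> \<bar>u-s\<bar>\<^sup>-\<^sup>H ds du\<close>, because \<open>B(u) - B(s)\<close> has a density bounded by a
  multiple of \<open>\<bar>u-s\<bar>\<^sup>-\<^sup>H\<close>. Small values are harmful, for small \<open>\<alpha>\<close>, only if they are spread over
  distant levels. Weighting the levels by a power of \<open>1 + x\<^sup>2\<close> excludes this: by the occupation formula
  the weighted integral of the local time is an integral of Gaussian moments of \<open>B\<close>.
\<close>

section \<open>The Cramer--Wold device\<close>

text \<open>A bounded weight \<open>Z\<close> of varying sign defines a signed measure \<open>A \<mapsto> E[Z; X \<in> A]\<close>. Adding \<open>2\<close> makes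
  the weight at least \<open>1\<close>, so that it can be normalized to a probability density and uniqueness of
  characteristic functions applies; the summand \<open>2\<close> only adds a multiple of the law of \<open>X\<close>.\<close>

lemma (in prob_space) tilted_law:
  fixes X Z :: "'a \<Rightarrow> real"
  assumes X[measurable]: "X \<in> borel_measurable M" and Z[measurable]: "Z \<in> borel_measurable M"
    and bound: "\<And>\<omega>. \<omega> \<in> space M \<Longrightarrow> \<bar>Z \<omega>\<bar> \<le> 1"
  defines "m \<equiv> expectation (\<lambda>\<omega>. 2 + Z \<omega>)"
    and "D \<equiv> distr (density M (\<lambda>\<omega>. ennreal ((2 + Z \<omega>) / expectation (\<lambda>\<omega>. 2 + Z \<omega>)))) borel X"
  shows "1 \<le> m" and "real_distribution D"
    and "char D \<theta> =
      (2 * (CLINT \<omega>|M. iexp (\<theta> * X \<omega>)) + (CLINT \<omega>|M. iexp (\<theta> * X \<omega>) * Z \<omega>)) / m"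
    and "A \<in> sets borel \<Longrightarrow> measure D A =
      (2 * (\<integral>\<omega>. indicator A (X \<omega>) \<partial>M) + (\<integral>\<omega>. indicator A (X \<omega>) * Z \<omega> \<partial>M)) / m"
proof -
  define d where "d = (\<lambda>\<omega>. (2 + Z \<omega>) / m)"
  have D: "D = distr (density M (\<lambda>\<omega>. ennreal (d \<omega>))) borel X"
    by (simp add: D_def d_def m_def)
  have iZ: "integrable M Z"
    by (rule integrable_const_bound[where B=1]) (use bound in auto)
  have ge1: "1 \<le> 2 + Z \<omega>" if "\<omega> \<in> space M" for \<omega>
    using bound[OF that] by linarith
  show m: "1 \<le> m" unfolding m_def
    by (rule integral_ge_const) (use iZ ge1 in auto)
  have dm[measurable]: "d \<in> borel_measurable M" unfolding d_def by measurable
  have d0: "AE \<omega> in M. 0 \<le> d \<omega>"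
    using ge1 m by (auto simp: d_def intro!: AE_I2 divide_nonneg_nonneg) (smt (verit))
  have "emeasure (density M (\<lambda>\<omega>. ennreal (d \<omega>))) (space M) = (\<integral>\<^sup>+\<omega>. ennreal (d \<omega>) \<partial>M)"
    by (subst emeasure_density) (auto intro!: nn_integral_cong)
  also have "\<dots> = ennreal (\<integral>\<omega>. d \<omega> \<partial>M)"
    by (rule nn_integral_eq_integral) (use iZ d0 in \<open>auto simp: d_def\<close>)
  also have "(\<integral>\<omega>. d \<omega> \<partial>M) = 1" using m by (simp add: d_def m_def[symmetric])
  finally have "prob_space (density M (\<lambda>\<omega>. ennreal (d \<omega>)))" by (intro prob_spaceI) simp
  then show rd: "real_distribution D" unfolding D
    by (intro real_distribution_distr prob_space.real_distribution_distr) auto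
  have iX: "integrable M (\<lambda>\<omega>. iexp (\<theta> * X \<omega>))"
    by (rule integrable_const_bound[where B=1]) (auto simp del: of_real_mult)
  have iXZ: "integrable M (\<lambda>\<omega>. iexp (\<theta> * X \<omega>) * Z \<omega>)"
    by (rule integrable_const_bound[where B=1])
      (use bound in \<open>auto simp: norm_mult simp del: of_real_mult\<close>)
  have "char D \<theta> = (CLINT \<omega>|M. d \<omega> *\<^sub>R iexp (\<theta> * X \<omega>))"
    unfolding char_def D using d0
    by (subst integral_distr) (auto simp: integral_density)
  also have "\<dots> = (CLINT \<omega>|M. (2 * iexp (\<theta> * X \<omega>) + iexp (\<theta> * X \<omega>) * Z \<omega>) / m)"
    by (intro Bochner_Integration.integral_cong)
      (auto simp: d_def scaleR_conv_of_real algebra_simps add_divide_distrib)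
  also have "\<dots> = (CLINT \<omega>|M. 2 * iexp (\<theta> * X \<omega>) + iexp (\<theta> * X \<omega>) * Z \<omega>) / m"
    by simp
  also have "\<dots> = ((CLINT \<omega>|M. 2 * iexp (\<theta> * X \<omega>)) + (CLINT \<omega>|M. iexp (\<theta> * X \<omega>) * Z \<omega>)) / m"
    using iX iXZ by (subst Bochner_Integration.integral_add) auto
  finally show "char D \<theta> =
      (2 * (CLINT \<omega>|M. iexp (\<theta> * X \<omega>)) + (CLINT \<omega>|M. iexp (\<theta> * X \<omega>) * Z \<omega>)) / m"
    by simp
  assume A[measurable]: "A \<in> sets borel"
  interpret D: real_distribution D by fact
  have iA: "integrable M (\<lambda>\<omega>. indicator A (X \<omega>) :: real)"
    by (rule integrable_const_bound[where B=1]) auto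
  have iAZ: "integrable M (\<lambda>\<omega>. indicator A (X \<omega>) * Z \<omega>)"
    by (rule integrable_const_bound[where B=1])
      (use bound in \<open>auto simp: indicator_def\<close>)
  have "measure D A = (\<integral>x. indicator A x \<partial>D)" by simp
  also have "\<dots> = (\<integral>\<omega>. d \<omega> * indicator A (X \<omega>) \<partial>M)"
    unfolding D using d0 by (subst integral_distr) (auto simp: integral_density)
  also have "\<dots> = (\<integral>\<omega>. (2 * indicator A (X \<omega>) + indicator A (X \<omega>) * Z \<omega>) / m \<partial>M)"
    by (intro Bochner_Integration.integral_cong) (auto simp: d_def indicator_def)
  also have "\<dots> = (2 * (\<integral>\<omega>. indicator A (X \<omega>) \<partial>M) + (\<integral>\<omega>. indicator A (X \<omega>) * Z \<omega> \<partial>M)) / m"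
    using iA iAZ by simp
  finally show "measure D A =
      (2 * (\<integral>\<omega>. indicator A (X \<omega>) \<partial>M) + (\<integral>\<omega>. indicator A (X \<omega>) * Z \<omega> \<partial>M)) / m" .
qed

text \<open>A weighted uniqueness theorem: the two tilted laws have the same characteristic function and
  the same normalizing constant, by the hypothesis on weighted transforms (at \<open>\<theta> = 0\<close> for the
  constant).\<close>

lemma (in prob_space) expectation_indicator_cong_char:
  fixes X X' Z Z' :: "'a \<Rightarrow> real"
  assumes [measurable]: "X \<in> borel_measurable M" "X' \<in> borel_measurable M"
    "Z \<in> borel_measurable M" "Z' \<in> borel_measurable M" "A \<in> sets borel"
    and bound: "\<And>\<omega>. \<omega> \<in> space M \<Longrightarrow> \<bar>Z \<omega>\<bar> \<le> 1" "\<And>\<omega>. \<omega> \<in> space M \<Longrightarrow> \<bar>Z' \<omega>\<bar> \<le> 1"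
    and law: "\<And>\<theta>. (CLINT \<omega>|M. iexp (\<theta> * X \<omega>)) = (CLINT \<omega>|M. iexp (\<theta> * X' \<omega>))"
    and weighted: "\<And>\<theta>. (CLINT \<omega>|M. iexp (\<theta> * X \<omega>) * Z \<omega>) = (CLINT \<omega>|M. iexp (\<theta> * X' \<omega>) * Z' \<omega>)"
  shows "(\<integral>\<omega>. indicator A (X \<omega>) * Z \<omega> \<partial>M) = (\<integral>\<omega>. indicator A (X' \<omega>) * Z' \<omega> \<partial>M)"
proof -
  let ?m = "\<lambda>Z. expectation (\<lambda>\<omega>. 2 + Z \<omega>)"
  let ?D = "\<lambda>X Z. distr (density M (\<lambda>\<omega>. ennreal ((2 + Z \<omega>) / ?m Z))) borel X"
  have iZ: "integrable M Z" "integrable M Z'"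
    by (rule integrable_const_bound[where B=1]; use bound in auto)+
  from weighted[of 0] have "expectation Z = expectation Z'"
    by (simp add: integral_complex_of_real)
  then have m: "?m Z = ?m Z'" using iZ by simp
  note T = tilted_law[of X Z] and T' = tilted_law[of X' Z']
  have char: "char (?D X Z) \<theta> = char (?D X' Z') \<theta>" for \<theta>
    by (simp only: T(3)[OF assms(1,3) bound(1)] T'(3)[OF assms(2,4) bound(2)] law weighted) (simp only: m)
  have char_eq: "?D X Z = ?D X' Z'"
    by (rule Levy_uniqueness[OF T(2) T'(2)])
      (use bound char in \<open>auto intro!: ext\<close>)
  moreover have "(\<integral>\<omega>. indicator A (X \<omega>) \<partial>M) = (\<integral>\<omega>. indicator A (X' \<omega>) \<partial>M :: real)"
  proof -
    have "distr M borel X = distr M borel X'"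
      by (rule Levy_uniqueness) (auto simp: char_def integral_distr law[simplified])
    moreover have "(\<integral>x. indicator A x \<partial>distr M borel Y) = (\<integral>\<omega>. indicator A (Y \<omega>) \<partial>M :: real)"
      if "Y \<in> borel_measurable M" for Y
      by (rule integral_distr[OF that]) measurable
    ultimately show ?thesis by (metis assms(1,2))
  qed
  moreover have "?m Z \<ge> 1" by (rule T(1)) (auto simp: bound)
  ultimately show ?thesis
    using T(4)[of A] T'(4)[of A] bound by (simp add: m)
qed

text \<open>The joint law is recovered one coordinate at a time: in the joint characteristic function,
  the exponentials belonging to the coordinates in \<open>K\<close> are successively replaced by indicators, while
  everything else plays the part of a bounded complex weight \<open>W\<close> in the weighted uniqueness theorem.\<close>

lemma (in prob_space) expectation_indicators_cong_iexp:
  fixes X X' :: "'i \<Rightarrow> 'a \<Rightarrow> real"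
  assumes fin: "finite K" "finite L" and disj: "K \<inter> L = {}"
    and [measurable]: "\<And>i. i \<in> K \<union> L \<Longrightarrow> X i \<in> borel_measurable M"
      "\<And>i. i \<in> K \<union> L \<Longrightarrow> X' i \<in> borel_measurable M"
      "\<And>i. i \<in> K \<Longrightarrow> A i \<in> sets borel"
    and char_eq: "\<And>c. (CLINT \<omega>|M. iexp (\<Sum>i\<in>K \<union> L. c i * X i \<omega>)) =
       (CLINT \<omega>|M. iexp (\<Sum>i\<in>K \<union> L. c i * X' i \<omega>))"
  shows "(CLINT \<omega>|M. of_real (\<Prod>i\<in>K. indicator (A i) (X i \<omega>)) * iexp (\<Sum>i\<in>L. c i * X i \<omega>)) =
    (CLINT \<omega>|M. of_real (\<Prod>i\<in>K. indicator (A i) (X' i \<omega>)) * iexp (\<Sum>i\<in>L. c i * X' i \<omega>))"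
  using assms
proof (induction K arbitrary: L c rule: finite_induct)
  case empty
  then show ?case by simp
next
  case (insert k K)
  note [measurable] = insert.prems(3,4,5)
  define W where "W = (\<lambda>(X :: 'i \<Rightarrow> 'a \<Rightarrow> real) c \<omega>. complex_of_real (\<Prod>i\<in>K. indicator (A i) (X i \<omega>)) * iexp (\<Sum>i\<in>L. c i * X i \<omega>))"
  have kL: "k \<notin> L" using insert.prems(2) by auto
  have IH: "(CLINT \<omega>|M. of_real (\<Prod>i\<in>K. indicator (A i) (X i \<omega>)) * iexp (\<Sum>i\<in>insert k L. c i * X i \<omega>)) =
    (CLINT \<omega>|M. of_real (\<Prod>i\<in>K. indicator (A i) (X' i \<omega>)) * iexp (\<Sum>i\<in>insert k L. c i * X' i \<omega>))" for c
    using insert.prems insert.hyps by (intro insert.IH) auto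
  have step: "(CLINT \<omega>|M. iexp (\<theta> * X k \<omega>) * W X c \<omega>) = (CLINT \<omega>|M. iexp (\<theta> * X' k \<omega>) * W X' c \<omega>)" for \<theta> c
  proof -
    have upd: "(\<Sum>i\<in>insert k L. (c(k := \<theta>)) i * Y i \<omega>) = \<theta> * Y k \<omega> + (\<Sum>i\<in>L. c i * Y i \<omega>)"
      for Y :: "'i \<Rightarrow> 'a \<Rightarrow> real" and \<omega>
      using insert.prems(1) kL by (subst sum.insert) (auto intro!: sum.cong)
    show ?thesis
      using IH[of "c(k := \<theta>)", unfolded upd] unfolding W_def
      by (simp add: distrib_left exp_add mult_ac del: of_real_sum of_real_prod of_real_mult)
  qed
  have Wm[measurable]: "W X c \<in> borel_measurable M" "W X' c \<in> borel_measurable M" for c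
    unfolding W_def by measurable
  have P1: "norm (\<Prod>i\<in>K. indicator (A i) (Y i \<omega>) :: real) \<le> 1" for Y :: "'i \<Rightarrow> 'a \<Rightarrow> real" and \<omega>
    unfolding prod_norm[symmetric] by (rule prod_le_1) (auto simp: indicator_def)
  have W1: "norm (W Y c \<omega>) \<le> 1" for Y c \<omega>
    unfolding W_def norm_mult using P1[of Y \<omega>] by (simp del: of_real_prod of_real_sum)
  (* Conjugation reverses the signs of the coefficients, so the real and imaginary part of the weight
     are again combinations of transforms covered by the induction hypothesis. *)
  have cnjW: "cnj (W Y c \<omega>) = W Y (\<lambda>i. - c i) \<omega>" for Y c \<omega>
    unfolding W_def by (simp add: exp_cnj sum_negf)
  have int: "integrable M (\<lambda>\<omega>. iexp (\<theta> * X k \<omega>) * W X c \<omega>)" "integrable M (\<lambda>\<omega>. iexp (\<theta> * X' k \<omega>) * W X' c \<omega>)" for \<theta> c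
    by (rule integrable_const_bound[where B=1]; use W1 in \<open>auto simp: norm_mult simp del: of_real_mult\<close>)+
  have Re_W: "complex_of_real (Re (W Y c \<omega>)) = (W Y c \<omega> + W Y (\<lambda>i. - c i) \<omega>) / 2" for Y c \<omega>
    unfolding cnjW[symmetric] by (simp add: complex_add_cnj)
  have Im_W: "complex_of_real (Im (W Y c \<omega>)) = (W Y c \<omega> - W Y (\<lambda>i. - c i) \<omega>) / (2 * \<i>)" for Y c \<omega>
    unfolding cnjW[symmetric] complex_diff_cnj by (simp add: complex_eq_iff)
  have law: "(CLINT \<omega>|M. iexp (\<theta> * X k \<omega>)) = (CLINT \<omega>|M. iexp (\<theta> * X' k \<omega>))" for \<theta>
  proof -
    have "(\<Sum>i\<in>insert k K \<union> L. (if i = k then \<theta> else 0) * Y i \<omega>) = \<theta> * Y k \<omega>" for Y :: "'i \<Rightarrow> 'a \<Rightarrow> real" and \<omega>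
      using insert.hyps insert.prems(1) by (simp add: if_distrib[of "\<lambda>x. x * _"] sum.delta' cong: if_cong)
    then show ?thesis using insert.prems(6)[of "\<lambda>i. if i = k then \<theta> else 0"] by simp
  qed
  have Re_eq: "(\<integral>\<omega>. indicator (A k) (X k \<omega>) * Re (W X c \<omega>) \<partial>M) = (\<integral>\<omega>. indicator (A k) (X' k \<omega>) * Re (W X' c \<omega>) \<partial>M)"
    using W1 law step int
    by (intro expectation_indicator_cong_char)
      (auto intro: abs_Re_le_cmod[THEN order_trans] simp: Re_W distrib_left add_divide_distrib)
  have Im_factor: "iexp (\<theta> * Y k \<omega>) * of_real (Im (W Y c \<omega>)) =
      (iexp (\<theta> * Y k \<omega>) * W Y c \<omega> - iexp (\<theta> * Y k \<omega>) * W Y (\<lambda>i. - c i) \<omega>) / (2 * \<i>)" for Y c \<omega> \<theta>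
    by (simp only: Im_W right_diff_distrib times_divide_eq_right)
  have "(CLINT \<omega>|M. iexp (\<theta> * X k \<omega>) * of_real (Im (W X c \<omega>))) =
      (CLINT \<omega>|M. iexp (\<theta> * X' k \<omega>) * of_real (Im (W X' c \<omega>)))" for \<theta>
    unfolding Im_factor integral_divide_zero
    by (simp only: Bochner_Integration.integral_diff[OF int(1) int(1)] Bochner_Integration.integral_diff[OF int(2) int(2)] step)
  then have Im_eq: "(\<integral>\<omega>. indicator (A k) (X k \<omega>) * Im (W X c \<omega>) \<partial>M) = (\<integral>\<omega>. indicator (A k) (X' k \<omega>) * Im (W X' c \<omega>) \<partial>M)"
    using W1 law by (intro expectation_indicator_cong_char) (auto intro: abs_Im_le_cmod[THEN order_trans])
  have int2: "integrable M (\<lambda>\<omega>. of_real (indicator (A k) (X k \<omega>)) * W X c \<omega>)" 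
    "integrable M (\<lambda>\<omega>. of_real (indicator (A k) (X' k \<omega>)) * W X' c \<omega>)" 
    by (rule integrable_const_bound[where B=1]; use W1 in \<open>auto simp: norm_mult indicator_def\<close>)+
  have "(CLINT \<omega>|M. of_real (indicator (A k) (X k \<omega>)) * W X c \<omega>) = (CLINT \<omega>|M. of_real (indicator (A k) (X' k \<omega>)) * W X' c \<omega>)"
    using Re_eq Im_eq by (intro complex_eqI) (simp_all flip: integral_Re[OF int2(1)] integral_Re[OF int2(2)] integral_Im[OF int2(1)] integral_Im[OF int2(2)])
  then show ?case
    using insert.hyps unfolding W_def by (simp add: mult.assoc)
qed

lemma same_fddI_char:
  assumes "prob_space P"
    and [measurable]: "\<And>t. 0 \<le> t \<Longrightarrow> X t \<in> borel_measurable P" "\<And>t. 0 \<le> t \<Longrightarrow> X' t \<in> borel_measurable P"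
    and char_eq: "\<And>J c. finite J \<Longrightarrow> J \<subseteq> {0..} \<Longrightarrow>
      (CLINT \<omega>|P. iexp (\<Sum>t\<in>J. c t * X t \<omega>)) = (CLINT \<omega>|P. iexp (\<Sum>t\<in>J. c t * X' t \<omega>))"
  shows "same_fdd P X X'"
  unfolding same_fdd_def
proof safe
  interpret prob_space P by fact
  fix J :: "real set" assume J: "finite J" "J \<subseteq> {0..}"
  have [measurable]: "(\<lambda>\<omega>. \<lambda>t\<in>J. X t \<omega>) \<in> P \<rightarrow>\<^sub>M Pi\<^sub>M J (\<lambda>_. borel)" "(\<lambda>\<omega>. \<lambda>t\<in>J. X' t \<omega>) \<in> P \<rightarrow>\<^sub>M Pi\<^sub>M J (\<lambda>_. borel)"
    using J by (auto intro!: measurable_restrict)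
  show "distr P (Pi\<^sub>M J (\<lambda>_. borel)) (\<lambda>\<omega>. \<lambda>t\<in>J. X t \<omega>) = distr P (Pi\<^sub>M J (\<lambda>_. borel)) (\<lambda>\<omega>. \<lambda>t\<in>J. X' t \<omega>)"
  proof (rule measure_eqI_PiM_finite[OF J(1)])
    fix A assume A: "\<And>i. i \<in> J \<Longrightarrow> A i \<in> sets (borel :: real measure)"
    have pr: "emeasure (distr P (Pi\<^sub>M J (\<lambda>_. borel)) (\<lambda>\<omega>. \<lambda>t\<in>J. Y t \<omega>)) (Pi\<^sub>E J A) =
       ennreal (Re (CLINT \<omega>|P. of_real (\<Prod>i\<in>J. indicator (A i) (Y i \<omega>)) * iexp (\<Sum>i\<in>{}. 0 * Y i \<omega>)))"
      if [measurable]: "(\<lambda>\<omega>. \<lambda>t\<in>J. Y t \<omega>) \<in> P \<rightarrow>\<^sub>M Pi\<^sub>M J (\<lambda>_. borel)" for Y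
    proof -
      have PE[measurable]: "Pi\<^sub>E J A \<in> sets (Pi\<^sub>M J (\<lambda>_. borel))"
        using J A by (intro sets_PiM_I_finite) auto
      have ind: "(\<Prod>i\<in>J. indicator (A i) (Y i \<omega>) :: real) = indicator ((\<lambda>\<omega>. \<lambda>t\<in>J. Y t \<omega>) -` Pi\<^sub>E J A \<inter> space P) \<omega>" if "\<omega> \<in> space P" for \<omega>
        using J that by (auto simp: indicator_def PiE_iff prod_zero_iff intro!: prod.neutral)
      have "(CLINT \<omega>|P. of_real (\<Prod>i\<in>J. indicator (A i) (Y i \<omega>))) = complex_of_real (\<integral>\<omega>. (\<Prod>i\<in>J. indicator (A i) (Y i \<omega>)) \<partial>P)"
        by (rule integral_complex_of_real)
      also have "(\<integral>\<omega>. (\<Prod>i\<in>J. indicator (A i) (Y i \<omega>)) \<partial>P) = measure P ((\<lambda>\<omega>. \<lambda>t\<in>J. Y t \<omega>) -` Pi\<^sub>E J A \<inter> space P)"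
        by (subst Bochner_Integration.integral_cong[OF refl ind]) (auto simp: Int_absorb2)
      finally show ?thesis
        using PE by (simp add: emeasure_distr emeasure_eq_measure)
    qed
    have "(CLINT \<omega>|P. of_real (\<Prod>i\<in>J. indicator (A i) (X i \<omega>)) * iexp (\<Sum>i\<in>{}. 0 * X i \<omega>)) =
      (CLINT \<omega>|P. of_real (\<Prod>i\<in>J. indicator (A i) (X' i \<omega>)) * iexp (\<Sum>i\<in>{}. 0 * X' i \<omega>))"
      by (rule expectation_indicators_cong_iexp) (use J A char_eq in auto)
    then show "emeasure (distr P (Pi\<^sub>M J (\<lambda>_. borel)) (\<lambda>\<omega>. \<lambda>t\<in>J. X t \<omega>)) (Pi\<^sub>E J A) =
       emeasure (distr P (Pi\<^sub>M J (\<lambda>_. borel)) (\<lambda>\<omega>. \<lambda>t\<in>J. X' t \<omega>)) (Pi\<^sub>E J A)"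
      by (simp only: pr measurable)
  next
    show "range (\<lambda>n::nat. space (Pi\<^sub>M J (\<lambda>_. borel :: real measure))) \<subseteq> prod_algebra J (\<lambda>_. borel)"
      using J(1) by (auto simp: space_PiM intro!: prod_algebraI_finite)
    interpret D: prob_space "distr P (Pi\<^sub>M J (\<lambda>_. borel)) (\<lambda>\<omega>. \<lambda>t\<in>J. X t \<omega>)"
      by (rule prob_space_distr) measurable
    show "emeasure (distr P (Pi\<^sub>M J (\<lambda>_. borel)) (\<lambda>\<omega>. \<lambda>t\<in>J. X t \<omega>)) (space (Pi\<^sub>M J (\<lambda>_. borel))) \<noteq> \<infinity>" for i :: nat
      using D.emeasure_finite by simp
  qed auto
qed

section \<open>Centered Gaussian processes and the invariances of fractional Brownian motion\<close>

text \<open>A Gaussian law is parametrized by some \<open>\<mu>\<close> and \<open>\<sigma>\<close>; the first two moments of the standard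
  normal law identify \<open>\<mu>\<close> with the mean and \<open>\<sigma>\<^sup>2\<close> with the variance. The sign of \<open>\<sigma>\<close> is not
  determined.\<close>

lemma gaussian_rv_centered:
  assumes "prob_space P" and G: "gaussian_rv P X" and mean: "(\<integral>\<omega>. X \<omega> \<partial>P) = 0"
  obtains \<sigma> where "X \<in> borel_measurable P"
    and "distr P borel X = distr std_normal_distribution borel (\<lambda>z. \<sigma> * z)"
    and "integrable P X" and "integrable P (\<lambda>\<omega>. (X \<omega>)\<^sup>2)" and "(\<integral>\<omega>. (X \<omega>)\<^sup>2 \<partial>P) = \<sigma>\<^sup>2"
proof -
  interpret prob_space P by fact
  interpret N: real_distribution std_normal_distribution by (rule real_dist_normal_dist)
  from G obtain \<mu> \<sigma> where X[measurable]: "X \<in> borel_measurable P"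
    and law: "distr P borel X = distr std_normal_distribution borel (\<lambda>z. \<mu> + \<sigma> * z)"
    by (auto simp: gaussian_rv_def)
  have int: "integrable P (\<lambda>\<omega>. f (X \<omega>)) \<longleftrightarrow> integrable std_normal_distribution (\<lambda>z. f (\<mu> + \<sigma> * z))"
    "(\<integral>\<omega>. f (X \<omega>) \<partial>P) = (\<integral>z. f (\<mu> + \<sigma> * z) \<partial>std_normal_distribution)"
    if f[measurable]: "f \<in> borel_measurable borel" for f :: "real \<Rightarrow> real"
  proof -
    have "integrable P (\<lambda>\<omega>. f (X \<omega>)) \<longleftrightarrow> integrable (distr P borel X) f"
      by (rule integrable_distr_eq[symmetric]) measurable
    then show "integrable P (\<lambda>\<omega>. f (X \<omega>)) \<longleftrightarrow> integrable std_normal_distribution (\<lambda>z. f (\<mu> + \<sigma> * z))"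
      unfolding law by (subst (asm) integrable_distr_eq) auto
    have "(\<integral>\<omega>. f (X \<omega>) \<partial>P) = (\<integral>x. f x \<partial>distr P borel X)"
      by (rule integral_distr[symmetric]) measurable
    then show "(\<integral>\<omega>. f (X \<omega>) \<partial>P) = (\<integral>z. f (\<mu> + \<sigma> * z) \<partial>std_normal_distribution)"
      unfolding law by (subst (asm) integral_distr) auto
  qed
  have i1: "integrable std_normal_distribution (\<lambda>z. z)"
    using integrable_std_normal_distribution_moment[of 1] by simp
  have i2: "integrable std_normal_distribution (\<lambda>z. z\<^sup>2)"
    by (rule integrable_std_normal_distribution_moment)
  have m1: "(\<integral>z. z \<partial>std_normal_distribution) = 0"
    using integral_std_normal_distribution_moment_odd[of 1] by simp
  have m2: "(\<integral>z. z\<^sup>2 \<partial>std_normal_distribution) = 1"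
    using std_normal_distribution_even_moments(1)[of 1] by simp
  have "(\<integral>\<omega>. X \<omega> \<partial>P) = (\<integral>z. \<mu> + \<sigma> * z \<partial>std_normal_distribution)"
    using int(2)[of "\<lambda>x. x"] by simp
  also have "\<dots> = (\<integral>z. \<mu> \<partial>std_normal_distribution) + (\<integral>z. \<sigma> * z \<partial>std_normal_distribution)"
    by (rule Bochner_Integration.integral_add) (use i1 in auto)
  also have "\<dots> = \<mu>"
    unfolding integral_mult_right_zero m1 using N.prob_space by (simp add: measure_def)
  finally have "\<mu> = 0" using mean by simp
  note law = law[unfolded this] and int = int[unfolded this]
  show thesis
  proof (rule that[of \<sigma>])
    show "distr P borel X = distr std_normal_distribution borel (\<lambda>z. \<sigma> * z)" using law by simp
    have "integrable P (\<lambda>\<omega>. X \<omega>)"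
      by (rule int(1)[THEN iffD2]) (auto intro!: i1)
    then show "integrable P X" .
    show "integrable P (\<lambda>\<omega>. (X \<omega>)\<^sup>2)"
      by (rule int(1)[THEN iffD2]) (auto simp: power_mult_distrib intro!: i2)
    have "(\<integral>\<omega>. (X \<omega>)\<^sup>2 \<partial>P) = (\<integral>z. \<sigma>\<^sup>2 * z\<^sup>2 \<partial>std_normal_distribution)"
      by (subst int(2)) (auto simp: power_mult_distrib)
    also have "\<dots> = \<sigma>\<^sup>2" unfolding integral_mult_right_zero m2 by simp
    finally show "(\<integral>\<omega>. (X \<omega>)\<^sup>2 \<partial>P) = \<sigma>\<^sup>2" .
  qed fact
qed

lemma gaussian_rv_centered_char:
  assumes "prob_space P" and "gaussian_rv P X" and "(\<integral>\<omega>. X \<omega> \<partial>P) = 0"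
  shows "(CLINT \<omega>|P. iexp (X \<omega>)) = of_real (exp (- (\<integral>\<omega>. (X \<omega>)\<^sup>2 \<partial>P) / 2))"
proof -
  obtain \<sigma> where X[measurable]: "X \<in> borel_measurable P"
    and law: "distr P borel X = distr std_normal_distribution borel (\<lambda>z. \<sigma> * z)"
    and var: "(\<integral>\<omega>. (X \<omega>)\<^sup>2 \<partial>P) = \<sigma>\<^sup>2"
    using gaussian_rv_centered[OF assms] by metis
  have "(CLINT \<omega>|P. iexp (X \<omega>)) = (CLINT x|distr P borel X. iexp x)"
    by (subst integral_distr) auto
  also have "\<dots> = (CLINT z|std_normal_distribution. iexp (\<sigma> * z))"
    unfolding law by (subst integral_distr) auto
  also have "\<dots> = char std_normal_distribution \<sigma>" by (simp add: char_def)
  finally show ?thesis by (simp add: char_std_normal_distribution var)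
qed

lemma integrable_mult_of_squares:
  fixes f g :: "'a \<Rightarrow> real"
  assumes [measurable]: "f \<in> borel_measurable M" "g \<in> borel_measurable M"
    and int: "integrable M (\<lambda>x. (f x)\<^sup>2)" "integrable M (\<lambda>x. (g x)\<^sup>2)"
  shows "integrable M (\<lambda>x. f x * g x)"
proof (rule Bochner_Integration.integrable_bound[OF Bochner_Integration.integrable_add[OF int]])
  have "\<bar>a * b\<bar> \<le> a\<^sup>2 + b\<^sup>2" for a b :: real
  proof -
    have "2 * (\<bar>a\<bar> * \<bar>b\<bar>) \<le> \<bar>a\<bar>\<^sup>2 + \<bar>b\<bar>\<^sup>2" using sum_squares_bound[of "\<bar>a\<bar>" "\<bar>b\<bar>"] by (simp add: mult_ac)
    moreover have "0 \<le> \<bar>a\<bar> * \<bar>b\<bar>" by simp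
    ultimately show ?thesis unfolding abs_mult power2_abs by linarith
  qed
  then show "AE x in M. norm (f x * g x) \<le> norm ((f x)\<^sup>2 + (g x)\<^sup>2)" by simp
qed measurable

locale centered_gaussian_process = prob_space P for P :: "'a measure" +
  fixes X :: "real \<Rightarrow> 'a \<Rightarrow> real"
  assumes gaussian: "gaussian_process P X"
    and mean: "\<And>t. 0 \<le> t \<Longrightarrow> expectation (X t) = 0"
begin

lemma gaussian_rv_value: "0 \<le> t \<Longrightarrow> gaussian_rv P (X t)"
  using gaussian[unfolded gaussian_process_def, rule_format, of "{t}" "\<lambda>_. 1"] by simp

lemma
  assumes "0 \<le> t"
  shows measurable_value: "X t \<in> borel_measurable P" and integrable_value: "integrable P (X t)"
    and integrable_square: "integrable P (\<lambda>\<omega>. (X t \<omega>)\<^sup>2)"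
  using gaussian_rv_centered[OF prob_space_axioms gaussian_rv_value[OF assms] mean[OF assms]] by metis+

lemma integrable_product:
  "0 \<le> s \<Longrightarrow> 0 \<le> t \<Longrightarrow> integrable P (\<lambda>\<omega>. X s \<omega> * X t \<omega>)"
  by (intro integrable_mult_of_squares measurable_value integrable_square)

lemma covariance_eq: "0 \<le> s \<Longrightarrow> 0 \<le> t \<Longrightarrow> covariance P (X s) (X t) = expectation (\<lambda>\<omega>. X s \<omega> * X t \<omega>)"
  by (simp add: covariance_def mean)

text \<open>Sampling times may coincide, as \<open>a\<close> and \<open>t + a\<close> do for \<open>t = 0\<close>; the coefficients at equal times are
  collected.\<close>

lemma gaussian_rv_sum:
  assumes J: "finite J" and \<tau>: "\<And>j. j \<in> J \<Longrightarrow> 0 \<le> \<tau> j"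
  shows "gaussian_rv P (\<lambda>\<omega>. \<Sum>j\<in>J. c j * X (\<tau> j) \<omega>)"
proof -
  have "(\<Sum>j\<in>J. c j * X (\<tau> j) \<omega>) = (\<Sum>t\<in>\<tau> ` J. (\<Sum>j\<in>{j \<in> J. \<tau> j = t}. c j) * X t \<omega>)" for \<omega>
  proof -
    have "(\<Sum>j\<in>J. c j * X (\<tau> j) \<omega>) = (\<Sum>t\<in>\<tau> ` J. \<Sum>j\<in>{j \<in> J. \<tau> j = t}. c j * X (\<tau> j) \<omega>)"
      by (rule sum.image_gen[OF J])
    also have "\<dots> = (\<Sum>t\<in>\<tau> ` J. \<Sum>j\<in>{j \<in> J. \<tau> j = t}. c j * X t \<omega>)"
      by (intro sum.cong refl) simp
    finally show ?thesis by (simp only: sum_distrib_right)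
  qed
  moreover have "gaussian_rv P (\<lambda>\<omega>. \<Sum>t\<in>\<tau> ` J. (\<Sum>j\<in>{j \<in> J. \<tau> j = t}. c j) * X t \<omega>)"
    by (rule gaussian[unfolded gaussian_process_def, rule_format]) (use J \<tau> in auto)
  ultimately show ?thesis by presburger
qed

lemma char_combination:
  assumes J: "finite J" "J \<subseteq> {0..}"
  shows "(CLINT \<omega>|P. iexp (\<Sum>t\<in>J. c t * X t \<omega>)) =
    of_real (exp (- (\<Sum>s\<in>J. \<Sum>t\<in>J. c s * c t * expectation (\<lambda>\<omega>. X s \<omega> * X t \<omega>)) / 2))"
proof -
  have pos: "0 \<le> t" if "t \<in> J" for t using that J by auto
  have "expectation (\<lambda>\<omega>. \<Sum>t\<in>J. c t * X t \<omega>) = (\<Sum>t\<in>J. c t * expectation (X t))"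
    by (subst Bochner_Integration.integral_sum) (auto intro!: integrable_value pos)
  also have "\<dots> = 0" by (simp add: mean pos)
  finally have "(CLINT \<omega>|P. iexp (\<Sum>t\<in>J. c t * X t \<omega>)) =
      of_real (exp (- expectation (\<lambda>\<omega>. (\<Sum>t\<in>J. c t * X t \<omega>)\<^sup>2) / 2))"
    by (intro gaussian_rv_centered_char gaussian_rv_sum prob_space_axioms) (auto simp: J(1) pos)
  also have "(\<lambda>\<omega>. (\<Sum>t\<in>J. c t * X t \<omega>)\<^sup>2) = (\<lambda>\<omega>. \<Sum>s\<in>J. \<Sum>t\<in>J. c s * c t * (X s \<omega> * X t \<omega>))"
    by (simp add: power2_eq_square sum_product mult_ac)
  also have "expectation \<dots> = (\<Sum>s\<in>J. expectation (\<lambda>\<omega>. \<Sum>t\<in>J. c s * c t * (X s \<omega> * X t \<omega>)))"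
    by (intro Bochner_Integration.integral_sum Bochner_Integration.integrable_sum integrable_mult_right
      integrable_product pos)
  also have "\<dots> = (\<Sum>s\<in>J. \<Sum>t\<in>J. expectation (\<lambda>\<omega>. c s * c t * (X s \<omega> * X t \<omega>)))"
    by (intro sum.cong refl Bochner_Integration.integral_sum integrable_mult_right integrable_product pos)
  also have "\<dots> = (\<Sum>s\<in>J. \<Sum>t\<in>J. c s * c t * expectation (\<lambda>\<omega>. X s \<omega> * X t \<omega>))"
    by simp
  finally show ?thesis .
qed

end

text \<open>The characteristic function of a combination depends on its variance alone, which is a
  quadratic form in the covariances.\<close>

lemma centered_gaussian_process_same_fdd:
  assumes "centered_gaussian_process P X" and "centered_gaussian_process P X'"
    and cov: "\<And>s t. 0 \<le> s \<Longrightarrow> 0 \<le> t \<Longrightarrow>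
      (\<integral>\<omega>. X s \<omega> * X t \<omega> \<partial>P) = (\<integral>\<omega>. X' s \<omega> * X' t \<omega> \<partial>P)"
  shows "same_fdd P X X'"
proof -
  interpret X: centered_gaussian_process P X by fact
  interpret X': centered_gaussian_process P X' by fact
  show ?thesis
  proof (rule same_fddI_char)
    fix J :: "real set" and c assume J: "finite J" "J \<subseteq> {0..}"
    have "(\<Sum>s\<in>J. \<Sum>t\<in>J. c s * c t * X.expectation (\<lambda>\<omega>. X s \<omega> * X t \<omega>)) =
      (\<Sum>s\<in>J. \<Sum>t\<in>J. c s * c t * X.expectation (\<lambda>\<omega>. X' s \<omega> * X' t \<omega>))"
      using J by (intro sum.cong refl arg_cong2[where f="(*)"] cov) auto
    then show "(CLINT \<omega>|P. iexp (\<Sum>t\<in>J. c t * X t \<omega>)) = (CLINT \<omega>|P. iexp (\<Sum>t\<in>J. c t * X' t \<omega>))"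
      by (simp only: X.char_combination[OF J] X'.char_combination[OF J])
  qed (auto intro: X.prob_space_axioms X.measurable_value X'.measurable_value)
qed

context fractional_Brownian_motion
begin

sublocale centered_gaussian_process P B
  by unfold_locales (fact gaussian, fact mean_zero)

abbreviation V where "V \<equiv> expectation (\<lambda>\<omega>. (B 1 \<omega>)\<^sup>2)"

lemma expectation_product:
  "0 \<le> s \<Longrightarrow> 0 \<le> t \<Longrightarrow>
    expectation (\<lambda>\<omega>. B s \<omega> * B t \<omega>) = V / 2 * (t powr (2 * H) + s powr (2 * H) - \<bar>t - s\<bar> powr (2 * H))"
  using covariance covariance_eq by simp

lemma rescaled_gaussian: 
  assumes "0 < c" shows "centered_gaussian_process P (\<lambda>t \<omega>. c powr (- H) * B (c * t) \<omega>)"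
proof unfold_locales
  show "gaussian_process P (\<lambda>t \<omega>. c powr (- H) * B (c * t) \<omega>)"
    unfolding gaussian_process_def
  proof safe
    fix J :: "real set" and d :: "real \<Rightarrow> real" assume "finite J" "J \<subseteq> {0..}"
    then have "gaussian_rv P (\<lambda>\<omega>. \<Sum>t\<in>J. (d t * c powr (- H)) * B (c * t) \<omega>)"
      using assms by (intro gaussian_rv_sum) auto
    then show "gaussian_rv P (\<lambda>\<omega>. \<Sum>t\<in>J. d t * (c powr (- H) * B (c * t) \<omega>))"
      by (simp add: mult.assoc)
  qed
qed (use assms mean in auto)

lemma rescaled_same_fdd:
  assumes c: "0 < c" shows "same_fdd P (\<lambda>t \<omega>. c powr (- H) * B (c * t) \<omega>) B"
proof (rule centered_gaussian_process_same_fdd[OF rescaled_gaussian[OF c] centered_gaussian_process_axioms])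
  fix s t :: real assume st: "0 \<le> s" "0 \<le> t"
  have "expectation (\<lambda>\<omega>. (c powr (- H) * B (c * s) \<omega>) * (c powr (- H) * B (c * t) \<omega>)) =
      expectation (\<lambda>\<omega>. (c powr (- H))\<^sup>2 * (B (c * s) \<omega> * B (c * t) \<omega>))"
    by (simp add: power2_eq_square mult_ac)
  also have "\<dots> = (c powr (- H))\<^sup>2 * expectation (\<lambda>\<omega>. B (c * s) \<omega> * B (c * t) \<omega>)"
    by simp
  also have "\<dots> = (c powr (- H))\<^sup>2 * (V / 2 * ((c * t) powr (2 * H) + (c * s) powr (2 * H) - \<bar>c * t - c * s\<bar> powr (2 * H)))"
    using st c by (subst expectation_product) auto
  also have "\<bar>c * t - c * s\<bar> = c * \<bar>t - s\<bar>"
    using c by (simp add: abs_mult flip: right_diff_distrib)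
  also have "(c powr (- H))\<^sup>2 = c powr (- (2 * H))"
    using c by (simp add: powr_power)
  also have "(c * t) powr (2 * H) + (c * s) powr (2 * H) - (c * \<bar>t - s\<bar>) powr (2 * H) =
      c powr (2 * H) * (t powr (2 * H) + s powr (2 * H) - \<bar>t - s\<bar> powr (2 * H))"
    using c st by (simp add: powr_mult algebra_simps)
  also have "c powr (- (2 * H)) * (V / 2 * (c powr (2 * H) * (t powr (2 * H) + s powr (2 * H) - \<bar>t - s\<bar> powr (2 * H)))) =
     (c powr (- (2 * H)) * c powr (2 * H)) * (V / 2 * (t powr (2 * H) + s powr (2 * H) - \<bar>t - s\<bar> powr (2 * H)))"
    by (simp only: mult_ac)
  also have "c powr (- (2 * H)) * c powr (2 * H) = 1" using c by (simp flip: powr_add)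
  finally show "expectation (\<lambda>\<omega>. (c powr (- H) * B (c * s) \<omega>) * (c powr (- H) * B (c * t) \<omega>)) =
      expectation (\<lambda>\<omega>. B s \<omega> * B t \<omega>)"
    using st by (simp add: expectation_product)
qed

lemma increments_gaussian: 
  assumes a: "0 \<le> a" shows "centered_gaussian_process P (\<lambda>t \<omega>. B (t + a) \<omega> - B a \<omega>)"
proof unfold_locales
  show "gaussian_process P (\<lambda>t \<omega>. B (t + a) \<omega> - B a \<omega>)"
    unfolding gaussian_process_def
  proof safe
    fix J :: "real set" and d :: "real \<Rightarrow> real" assume J: "finite J" "J \<subseteq> {0..}"
    (* None stands for the common subtracted value B(a), whose coefficients add up. *)
    define \<tau> where "\<tau> j = (case j of None \<Rightarrow> a | Some t \<Rightarrow> t + a)" for j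
    define e where "e j = (case j of None \<Rightarrow> - (\<Sum>t\<in>J. d t) | Some t \<Rightarrow> d t)" for j
    have "gaussian_rv P (\<lambda>\<omega>. \<Sum>j\<in>insert None (Some ` J). e j * B (\<tau> j) \<omega>)"
      using a J by (intro gaussian_rv_sum) (auto simp: \<tau>_def)
    also have "(\<lambda>\<omega>. \<Sum>j\<in>insert None (Some ` J). e j * B (\<tau> j) \<omega>) = (\<lambda>\<omega>. \<Sum>t\<in>J. d t * (B (t + a) \<omega> - B a \<omega>))"
      using J by (subst sum.insert)
       (auto simp: sum.reindex e_def \<tau>_def right_diff_distrib sum_subtractf sum_distrib_right)
    finally show "gaussian_rv P (\<lambda>\<omega>. \<Sum>t\<in>J. d t * (B (t + a) \<omega> - B a \<omega>))" .
  qed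
  fix t :: real assume "0 \<le> t"
  with a show "expectation (\<lambda>\<omega>. B (t + a) \<omega> - B a \<omega>) = 0"
    by (subst Bochner_Integration.integral_diff) (auto intro!: integrable_value simp: mean)
qed

lemma expectation_increments_product:
  assumes "0 \<le> a" "0 \<le> s" "0 \<le> t"
  shows "expectation (\<lambda>\<omega>. (B (s + a) \<omega> - B a \<omega>) * (B (t + a) \<omega> - B a \<omega>)) =
    expectation (\<lambda>\<omega>. B s \<omega> * B t \<omega>)"
proof -
  note int = integrable_product
  have "expectation (\<lambda>\<omega>. (B (s + a) \<omega> - B a \<omega>) * (B (t + a) \<omega> - B a \<omega>)) =
    expectation (\<lambda>\<omega>. (B (s + a) \<omega> * B (t + a) \<omega> - B (s + a) \<omega> * B a \<omega>) - (B a \<omega> * B (t + a) \<omega> - B a \<omega> * B a \<omega>))"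
    by (simp add: algebra_simps)
  also have "\<dots> = (expectation (\<lambda>\<omega>. B (s + a) \<omega> * B (t + a) \<omega>) - expectation (\<lambda>\<omega>. B (s + a) \<omega> * B a \<omega>)) -
     (expectation (\<lambda>\<omega>. B a \<omega> * B (t + a) \<omega>) - expectation (\<lambda>\<omega>. B a \<omega> * B a \<omega>))"
    using assms by (simp add: int)
  also have "\<dots> = expectation (\<lambda>\<omega>. B s \<omega> * B t \<omega>)"
    using assms by (simp add: expectation_product algebra_simps)
  finally show ?thesis .
qed

lemma increments_same_fdd:
  assumes a: "0 \<le> a" shows "same_fdd P (\<lambda>t \<omega>. B (t + a) \<omega> - B a \<omega>) B"
  by (rule centered_gaussian_process_same_fdd[OF increments_gaussian[OF a] centered_gaussian_process_axioms])
    (rule expectation_increments_product[OF a])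

lemma expectation_square: "0 \<le> t \<Longrightarrow> expectation (\<lambda>\<omega>. (B t \<omega>)\<^sup>2) = V * t powr (2 * H)"
  using expectation_product[of t t] by (simp add: power2_eq_square)

end

section \<open>The law of a local time is determined by the law of the process\<close>

text \<open>A compactly supported continuous probability density, used to mollify the Dirac mass at a
  level. Continuity makes Riemann sums along a path converge; compact support makes continuity of
  the local time in the level sufficient.\<close>

definition tent :: "real \<Rightarrow> real" where
  "tent y = max 0 (1 - \<bar>y\<bar>)"

lemma tent_nonneg: "0 \<le> tent y" and tent_le_1: "tent y \<le> 1"
  and tent_eq_0: "1 \<le> \<bar>y\<bar> \<Longrightarrow> tent y = 0"
  by (auto simp: tent_def)

lemma continuous_on_tent[continuous_intros]:
  "continuous_on S f \<Longrightarrow> continuous_on S (\<lambda>x. tent (f x))"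
  unfolding tent_def by (intro continuous_intros)

lemma tent_measurable[measurable]: "tent \<in> borel_measurable borel"
  by (intro borel_measurable_continuous_onI continuous_intros)

lemma integrable_tent_mult:
  assumes "continuous_on UNIV g"
  shows "integrable lborel (\<lambda>z. tent z * g z)"
proof -
  have "integrable lborel (\<lambda>z. indicator {-1..1} z *\<^sub>R (tent z * g z))"
    by (rule borel_integrable_compact) (auto intro!: continuous_intros continuous_on_subset[OF assms])
  also have "(\<lambda>z. indicator {-1..1} z *\<^sub>R (tent z * g z)) = (\<lambda>z. tent z * g z)"
    by (auto simp: indicator_def tent_def fun_eq_iff)
  finally show ?thesis .
qed

lemma integral_tent: "(\<integral>z. tent z \<partial>lborel) = 1"
proof -
  have "(tent has_integral ((0 + 0\<^sup>2/2) - ((-1) + (-1)\<^sup>2/2))) {-1..0}"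
  proof (rule fundamental_theorem_of_calculus)
    fix x :: real assume x: "x \<in> {-1..0}"
    have "((\<lambda>z. z + z\<^sup>2/2) has_vector_derivative tent x) (at x within {-1..0})"
      using x unfolding has_real_derivative_iff_has_vector_derivative[symmetric]
      by (auto simp: tent_def intro!: derivative_eq_intros)
    then show "((\<lambda>z. z + z\<^sup>2/2) has_vector_derivative tent x) (at x within {-1..0})" .
  qed simp
  moreover have "(tent has_integral ((1 - 1\<^sup>2/2) - (0 - 0\<^sup>2/2))) {0..1}"
  proof (rule fundamental_theorem_of_calculus)
    fix x :: real assume x: "x \<in> {0..1}"
    have "((\<lambda>z. z - z\<^sup>2/2) has_vector_derivative tent x) (at x within {0..1})"
      using x unfolding has_real_derivative_iff_has_vector_derivative[symmetric]
      by (auto simp: tent_def intro!: derivative_eq_intros)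
    then show "((\<lambda>z. z - z\<^sup>2/2) has_vector_derivative tent x) (at x within {0..1})" .
  qed simp
  ultimately have "(tent has_integral 1) {-1..1}"
    using has_integral_combine[of "-1" 0 1 tent "1/2" "1/2"] by simp
  then have "(tent has_integral 1) UNIV"
    by (rule has_integral_on_superset) (auto simp: tent_eq_0)
  moreover have "integrable lborel tent" using integrable_tent_mult[of "\<lambda>_. 1"] by simp
  ultimately show ?thesis
    using has_integral_integral_lborel has_integral_unique by blast
qed

text \<open>Rescaled tents form an approximate identity: after the substitution \<open>y = x + \<epsilon>z\<close> only
  arguments within distance \<open>\<epsilon>\<close> of \<open>x\<close> matter.\<close>

lemma tent_average_tendsto:
  fixes g :: "real \<Rightarrow> real"
  assumes g: "continuous_on UNIV g"
  shows "((\<lambda>\<epsilon>. (\<integral>y. tent ((y - x) / \<epsilon>) * g y \<partial>lborel) / \<epsilon>) \<longlongrightarrow> g x) (at_right 0)"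
proof (rule tendstoI)
  fix e :: real assume e: "0 < e"
  have [measurable]: "g \<in> borel_measurable borel" by (rule borel_measurable_continuous_onI[OF g])
  obtain d where d: "0 < d" "\<And>y. \<bar>y - x\<bar> < d \<Longrightarrow> \<bar>g y - g x\<bar> < e / 2"
    using g[unfolded continuous_on_iff, rule_format, of x "e / 2"] e by (auto simp: dist_real_def)
  have intk: "integrable lborel (\<lambda>z. tent z)" using integrable_tent_mult[of "\<lambda>_. 1"] by simp
  have "dist ((\<integral>y. tent ((y - x) / \<epsilon>) * g y \<partial>lborel) / \<epsilon>) (g x) < e" if \<epsilon>: "0 < \<epsilon>" "\<epsilon> < d" for \<epsilon>
  proof -
    have "(\<integral>y. tent ((y - x) / \<epsilon>) * g y \<partial>lborel) / \<epsilon> = (\<integral>z. tent z * g (x + \<epsilon> * z) \<partial>lborel)"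
      using \<epsilon> by (subst lborel_integral_real_affine[where c=\<epsilon> and t=x]) auto
    then have "(\<integral>y. tent ((y - x) / \<epsilon>) * g y \<partial>lborel) / \<epsilon> - g x = (\<integral>z. tent z * g (x + \<epsilon> * z) \<partial>lborel) - (\<integral>z. tent z * g x \<partial>lborel)"
      by (simp add: integral_tent)
    also have "\<dots> = (\<integral>z. tent z * g (x + \<epsilon> * z) - tent z * g x \<partial>lborel)"
      by (intro Bochner_Integration.integral_diff[symmetric] integrable_tent_mult continuous_intros
          continuous_on_compose2[OF g]) auto
    finally have eq: "(\<integral>y. tent ((y - x) / \<epsilon>) * g y \<partial>lborel) / \<epsilon> - g x = \<dots>" .
    have "norm (\<integral>z. tent z * g (x + \<epsilon> * z) - tent z * g x \<partial>lborel) \<le> (\<integral>z. tent z * (e / 2) \<partial>lborel)"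
    proof (rule Bochner_Integration.integral_norm_bound_integral)
      show "integrable lborel (\<lambda>z. tent z * g (x + \<epsilon> * z) - tent z * g x)"
        by (intro Bochner_Integration.integrable_diff integrable_tent_mult continuous_intros
          continuous_on_compose2[OF g]) auto
      show "integrable lborel (\<lambda>z. tent z * (e / 2))" using intk by simp
      fix z
      show "norm (tent z * g (x + \<epsilon> * z) - tent z * g x) \<le> tent z * (e / 2)"
      proof (cases "\<bar>z\<bar> < 1")
        case True
        then have "\<epsilon> * \<bar>z\<bar> \<le> \<epsilon> * 1" using \<epsilon> by (intro mult_left_mono) auto
        then have "\<bar>\<epsilon> * z\<bar> \<le> \<epsilon>" using \<epsilon>(1) by (simp only: abs_mult abs_of_pos mult_1_right)
        then have "\<bar>\<epsilon> * z\<bar> < d" using \<epsilon>(2) by simp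
        then have "\<bar>g (x + \<epsilon> * z) - g x\<bar> \<le> e / 2" using d(2)[of "x + \<epsilon> * z"] by simp
        then show ?thesis
          unfolding right_diff_distrib[symmetric] real_norm_def abs_mult abs_of_nonneg[OF tent_nonneg]
          by (rule mult_left_mono) (rule tent_nonneg)
      qed (simp add: tent_eq_0)
    qed
    also have "\<dots> < e" using e by (simp add: integral_tent)
    finally show ?thesis by (simp add: dist_real_def eq)
  qed
  then show "\<forall>\<^sub>F \<epsilon> in at_right 0. dist ((\<integral>y. tent ((y - x) / \<epsilon>) * g y \<partial>lborel) / \<epsilon>) (g x) < e"
    using d(1) unfolding eventually_at_right_field by blast
qed

text \<open>The time up to \<open>t\<close> that the path \<open>f\<close> spends near the level \<open>x\<close>, weighted by a tent of width \<open>\<epsilon>\<close>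
  and normalized to total mass one in the level.\<close>

definition occupation_average :: "(real \<Rightarrow> real) \<Rightarrow> real \<Rightarrow> real \<Rightarrow> real \<Rightarrow> real" where
  "occupation_average f x t \<epsilon> = (LBINT s:{0..t}. tent ((f s - x) / \<epsilon>)) / \<epsilon>"

lemma integrable_tent_path:
  fixes f :: "real \<Rightarrow> real"
  assumes "continuous_on {0..} f"
  shows "set_integrable lborel {0..t} (\<lambda>s. tent ((f s - x) / \<epsilon>))"
  unfolding set_integrable_def
proof (rule borel_integrable_compact)
  have "continuous_on {0..t} f" by (rule continuous_on_subset[OF assms]) auto
  then show "continuous_on {0..t} (\<lambda>s. tent ((f s - x) / \<epsilon>))"
    unfolding divide_inverse by (intro continuous_intros)
qed (rule compact_Icc)

text \<open>The occupation formula turns the time average into an average of \<open>L\<close> over levels.\<close>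

lemma occupation_average_tendsto:
  assumes f: "continuous_on {0..} f" and L: "continuous_on UNIV L" "\<And>y. 0 \<le> L y"
    and occ: "\<And>g :: real \<Rightarrow> ennreal. g \<in> borel_measurable borel \<Longrightarrow>
      (\<integral>\<^sup>+s\<in>{0..t}. g (f s) \<partial>lborel) = (\<integral>\<^sup>+y. g y * ennreal (L y) \<partial>lborel)"
  shows "((\<lambda>\<epsilon>. occupation_average f x t \<epsilon>) \<longlongrightarrow> L x) (at_right 0)"
proof (rule Lim_transform_eventually[OF tent_average_tendsto[OF L(1)]])
  have [measurable]: "L \<in> borel_measurable borel" by (rule borel_measurable_continuous_onI[OF L(1)])
  have "(\<integral>y. tent ((y - x) / \<epsilon>) * L y \<partial>lborel) / \<epsilon> = occupation_average f x t \<epsilon>" if \<epsilon>: "0 < \<epsilon>" for \<epsilon>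
  proof -
    have "integrable lborel (\<lambda>y. tent ((y - x) / \<epsilon>) * L y)"
      using \<epsilon> lborel_integrable_real_affine_iff[of \<epsilon> "\<lambda>y. tent ((y - x) / \<epsilon>) * L y" x]
      by (auto intro!: integrable_tent_mult continuous_on_compose2[OF L(1)] continuous_intros)
    then have "ennreal (\<integral>y. tent ((y - x) / \<epsilon>) * L y \<partial>lborel) = (\<integral>\<^sup>+y. ennreal (tent ((y - x) / \<epsilon>) * L y) \<partial>lborel)"
      by (subst nn_integral_eq_integral) (auto simp: tent_nonneg L)
    also have "\<dots> = (\<integral>\<^sup>+y. ennreal (tent ((y - x) / \<epsilon>)) * ennreal (L y) \<partial>lborel)"
      by (simp add: ennreal_mult tent_nonneg L)
    also have "\<dots> = (\<integral>\<^sup>+s\<in>{0..t}. ennreal (tent ((f s - x) / \<epsilon>)) \<partial>lborel)"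
      by (rule occ[symmetric]) measurable
    also have "\<dots> = (\<integral>\<^sup>+s. ennreal (indicator {0..t} s *\<^sub>R tent ((f s - x) / \<epsilon>)) \<partial>lborel)"
      by (intro nn_integral_cong) (auto simp: indicator_def)
    also have "\<dots> = ennreal (LBINT s:{0..t}. tent ((f s - x) / \<epsilon>))"
      unfolding set_lebesgue_integral_def
      using integrable_tent_path[OF f, of t x \<epsilon>, unfolded set_integrable_def]
      by (subst nn_integral_eq_integral) (auto simp: tent_nonneg)
    finally have "(\<integral>y. tent ((y - x) / \<epsilon>) * L y \<partial>lborel) = (LBINT s:{0..t}. tent ((f s - x) / \<epsilon>))"
      by (subst (asm) ennreal_inj) (auto simp: tent_nonneg L set_lebesgue_integral_def intro!: Bochner_Integration.integral_nonneg)
    then show ?thesis by (simp add: occupation_average_def)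
  qed
  then show "\<forall>\<^sub>F \<epsilon> in at_right 0. (\<integral>y. tent ((y - x) / \<epsilon>) * L y \<partial>lborel) / \<epsilon> = occupation_average f x t \<epsilon>"
    by (auto simp: eventually_at_right_field intro!: exI[of _ 1])
qed

text \<open>The length of the part of \<open>[0, t]\<close> in the cell \<open>[k/(N+1), (k+1)/(N+1))\<close>. The grid does not depend
  on \<open>t\<close>; the last cell is cut off.\<close>

definition grid_weight :: "nat \<Rightarrow> real \<Rightarrow> nat \<Rightarrow> real" where
  "grid_weight N t k = measure lborel ({s. \<lfloor>real (Suc N) * s\<rfloor> = int k} \<inter> {0..t})"

lemma floor_grid_tendsto: "(\<lambda>N. real_of_int \<lfloor>real (Suc N) * s\<rfloor> / real (Suc N)) \<longlonglongrightarrow> s"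
proof (rule tendsto_sandwich)
  have "s - 1 / real (Suc N) \<le> real_of_int \<lfloor>real (Suc N) * s\<rfloor> / real (Suc N)" for N
  proof -
    have "real (Suc N) * s - 1 \<le> real_of_int \<lfloor>real (Suc N) * s\<rfloor>" by linarith
    then have "(real (Suc N) * s - 1) / real (Suc N) \<le> real_of_int \<lfloor>real (Suc N) * s\<rfloor> / real (Suc N)"
      by (rule divide_right_mono) simp
    then show ?thesis by (simp add: diff_divide_distrib)
  qed
  then show "\<forall>\<^sub>F N in sequentially. s - 1 / real (Suc N) \<le> real_of_int \<lfloor>real (Suc N) * s\<rfloor> / real (Suc N)"
    by simp
  have "real_of_int \<lfloor>real (Suc N) * s\<rfloor> / real (Suc N) \<le> s" for N
  proof -
    have "real_of_int \<lfloor>real (Suc N) * s\<rfloor> / real (Suc N) \<le> (real (Suc N) * s) / real (Suc N)"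
      by (rule divide_right_mono) (auto simp: of_int_floor_le)
    then show ?thesis by simp
  qed
  then show "\<forall>\<^sub>F N in sequentially. real_of_int \<lfloor>real (Suc N) * s\<rfloor> / real (Suc N) \<le> s" by simp
  show "(\<lambda>N. s - 1 / real (Suc N)) \<longlonglongrightarrow> s"
    using LIMSEQ_inverse_real_of_nat_add_minus[of s] by (simp add: inverse_eq_divide)
qed simp

text \<open>The sum is the integral of \<open>h\<close> evaluated at the left grid point, and dominated convergence
  applies because left grid points converge.\<close>

lemma riemann_sum_tendsto:
  fixes h :: "real \<Rightarrow> real"
  assumes h: "continuous_on {0..} h" and bound: "\<And>s. \<bar>h s\<bar> \<le> C"
  shows "(\<lambda>N. \<Sum>k\<le>nat \<lfloor>real (Suc N) * t\<rfloor>. grid_weight N t k * h (real k / real (Suc N)))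
    \<longlonglongrightarrow> (LBINT s:{0..t}. h s)"
proof -
  define r where "r N s = real_of_int \<lfloor>real (Suc N) * s\<rfloor> / real (Suc N)" for N and s :: real
  have sum_eq: "(\<Sum>k\<le>nat \<lfloor>real (Suc N) * t\<rfloor>. grid_weight N t k * h (real k / real (Suc N))) =
      (\<integral>s. indicator {0..t} s * h (r N s) \<partial>lborel)"
    and meas: "(\<lambda>s. indicator {0..t} s * h (r N s)) \<in> borel_measurable lborel" for N
  proof -
    let ?K = "{..nat \<lfloor>real (Suc N) * t\<rfloor>}"
    let ?S = "\<lambda>k. {s. \<lfloor>real (Suc N) * s\<rfloor> = int k} \<inter> {0..t}"
    have fin: "emeasure lborel (?S k) < \<infinity>" for k
    proof -
      have "emeasure lborel (?S k) \<le> emeasure lborel {0..t}" by (rule emeasure_mono) auto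
      also have "\<dots> < \<infinity>" by (simp add: emeasure_lborel_Icc_eq)
      finally show ?thesis .
    qed
    have eq: "indicator {0..t} s * h (r N s) = (\<Sum>k\<in>?K. indicator (?S k) s * h (real k / real (Suc N)))" for s
    proof (cases "s \<in> {0..t}")
      case True
      then have "nat \<lfloor>real (Suc N) * s\<rfloor> \<in> ?K"
        by (auto intro!: nat_mono floor_mono mult_left_mono)
      moreover have "real (nat \<lfloor>real (Suc N) * s\<rfloor>) = real_of_int \<lfloor>real (Suc N) * s\<rfloor>"
        using True by simp
      moreover have "indicator (?S k) s * h (real k / real (Suc N)) =
          (if k = nat \<lfloor>real (Suc N) * s\<rfloor> then h (r N s) else 0)" for k
      proof (cases "\<lfloor>real (Suc N) * s\<rfloor> = int k")
        case True
        then have "k = nat \<lfloor>real (Suc N) * s\<rfloor>" by simp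
        then show ?thesis using True \<open>s \<in> {0..t}\<close> by (simp add: r_def)
      next
        case False
        moreover have "0 \<le> \<lfloor>real (Suc N) * s\<rfloor>" using \<open>s \<in> {0..t}\<close> by simp
        ultimately have "k \<noteq> nat \<lfloor>real (Suc N) * s\<rfloor>" by linarith
        then show ?thesis using False by simp
      qed
      ultimately show ?thesis using True by (simp add: sum.delta)
    next
      case False
      then show ?thesis by (auto simp: indicator_def intro!: sum.neutral)
    qed
    have int: "integrable lborel (\<lambda>s. indicator (?S k) s * h (real k / real (Suc N)))" for k
      using fin[of k] by (intro integrable_mult_left integrable_real_indicator) auto
    show "(\<lambda>s. indicator {0..t} s * h (r N s)) \<in> borel_measurable lborel"
      unfolding eq by (intro borel_measurable_sum borel_measurable_integrable int)
    show "(\<Sum>k\<le>nat \<lfloor>real (Suc N) * t\<rfloor>. grid_weight N t k * h (real k / real (Suc N))) =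
      (\<integral>s. indicator {0..t} s * h (r N s) \<partial>lborel)"
      unfolding eq by (subst Bochner_Integration.integral_sum) (intro int, simp add: grid_weight_def)
  qed
  have "(\<lambda>N. \<integral>s. indicator {0..t} s * h (r N s) \<partial>lborel) \<longlonglongrightarrow> (\<integral>s. indicator {0..t} s *\<^sub>R h s \<partial>lborel)"
  proof (rule integral_dominated_convergence)
    show "(\<lambda>s. indicator {0..t} s *\<^sub>R h s) \<in> borel_measurable lborel"
      using borel_measurable_continuous_on_indicator[OF _ continuous_on_subset[OF h], of "{0..t}"] by auto
    show "integrable lborel (\<lambda>s. indicator {0..t} s * C)"
      by (intro integrable_mult_left) (simp add: integrable_indicator_iff emeasure_lborel_Icc_eq)
    show "AE s in lborel. (\<lambda>N. indicator {0..t} s * h (r N s)) \<longlonglongrightarrow> indicator {0..t} s *\<^sub>R h s"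
    proof (rule AE_I2)
      fix s
      show "(\<lambda>N. indicator {0..t} s * h (r N s)) \<longlonglongrightarrow> indicator {0..t} s *\<^sub>R h s"
      proof (cases "s \<in> {0..t}")
        case True
        have "(\<lambda>N. h (r N s)) \<longlonglongrightarrow> h s"
          by (rule continuous_on_tendsto_compose[OF h]) (use floor_grid_tendsto True in \<open>auto simp: r_def\<close>)
        then show ?thesis using True by simp
      qed simp
    qed
    show "AE s in lborel. norm (indicator {0..t} s * h (r N s)) \<le> indicator {0..t} s * C" for N
      using bound by (auto simp: indicator_def)
  qed (rule meas)
  then show ?thesis by (simp only: sum_eq set_lebesgue_integral_def)
qed

text \<open>A description of local time by finite quantities only, as a pathwise limit of occupation averages. It
  passes directly to shifted and to rescaled processes: differences of averages at two times never
  have the form \<open>\<infinity> - \<infinity>\<close>, which may occur in the occupation formula for unbounded functions.\<close>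

locale continuous_process_local_time = prob_space P for P :: "'a measure" +
  fixes X :: "real \<Rightarrow> 'a \<Rightarrow> real" and l :: "real \<Rightarrow> real \<Rightarrow> 'a \<Rightarrow> real"
  assumes X_measurable: "\<And>t. 0 \<le> t \<Longrightarrow> X t \<in> borel_measurable P"
    and continuous_paths: "\<And>\<omega>. \<omega> \<in> space P \<Longrightarrow> continuous_on {0..} (\<lambda>t. X t \<omega>)"
    and l_measurable: "\<And>x t. 0 \<le> t \<Longrightarrow> l x t \<in> borel_measurable P"
    and averages: "AE \<omega> in P. \<forall>x. \<forall>t\<ge>0.
      ((\<lambda>\<epsilon>. occupation_average (\<lambda>s. X s \<omega>) x t \<epsilon>) \<longlongrightarrow> l x t \<omega>) (at_right 0)"

lemma continuous_process_local_timeI: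
  assumes "prob_space P" and "\<And>t. 0 \<le> t \<Longrightarrow> X t \<in> borel_measurable P"
    and paths: "\<And>\<omega>. \<omega> \<in> space P \<Longrightarrow> continuous_on {0..} (\<lambda>t. X t \<omega>)"
    and "jointly_continuous_local_time P X l"
  shows "continuous_process_local_time P X l"
proof -
  interpret prob_space P by fact
  interpret jointly_continuous_local_time P X l by fact
  show ?thesis
  proof
    show "AE \<omega> in P. \<forall>x. \<forall>t\<ge>0.
      ((\<lambda>\<epsilon>. occupation_average (\<lambda>s. X s \<omega>) x t \<epsilon>) \<longlongrightarrow> l x t \<omega>) (at_right 0)"
      using AE_space nonneg occupation
    proof eventually_elim
      case (elim \<omega>)
      show ?case
      proof (intro allI impI)
        fix x t :: real assume t: "0 \<le> t"
        have "continuous_on UNIV (\<lambda>y. (\<lambda>(x, t). l x t \<omega>) (y, t))"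
          by (rule continuous_on_compose2[OF jointly_continuous[OF elim(1)]])
            (use t in \<open>auto intro!: continuous_intros\<close>)
        then have "continuous_on UNIV (\<lambda>y. l y t \<omega>)" by simp
        then show "((\<lambda>\<epsilon>. occupation_average (\<lambda>s. X s \<omega>) x t \<epsilon>) \<longlongrightarrow> l x t \<omega>) (at_right 0)"
          using elim t by (intro occupation_average_tendsto[where L="\<lambda>y. l y t \<omega>"] paths) auto
      qed
    qed
  qed (use assms measurable in auto)
qed

lemma same_fdd_integral_eq:
  fixes G :: "(real \<Rightarrow> real) \<Rightarrow> complex"
  assumes fdd: "same_fdd P X X'" and K: "finite K" "K \<subseteq> {0..}"
    and X: "\<And>t. 0 \<le> t \<Longrightarrow> X t \<in> borel_measurable P" and X': "\<And>t. 0 \<le> t \<Longrightarrow> X' t \<in> borel_measurable P"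
    and G[measurable]: "G \<in> borel_measurable (Pi\<^sub>M K (\<lambda>_. borel))"
  shows "(\<integral>\<omega>. G (\<lambda>t\<in>K. X t \<omega>) \<partial>P) = (\<integral>\<omega>. G (\<lambda>t\<in>K. X' t \<omega>) \<partial>P)"
proof -
  have [measurable]: "(\<lambda>\<omega>. \<lambda>t\<in>K. X t \<omega>) \<in> P \<rightarrow>\<^sub>M Pi\<^sub>M K (\<lambda>_. borel)" "(\<lambda>\<omega>. \<lambda>t\<in>K. X' t \<omega>) \<in> P \<rightarrow>\<^sub>M Pi\<^sub>M K (\<lambda>_. borel)"
    using K by (auto intro!: measurable_restrict X X')
  have "(\<integral>\<omega>. G (\<lambda>t\<in>K. X t \<omega>) \<partial>P) = (\<integral>y. G y \<partial>distr P (Pi\<^sub>M K (\<lambda>_. borel)) (\<lambda>\<omega>. \<lambda>t\<in>K. X t \<omega>))"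
    by (subst integral_distr) auto
  also have "\<dots> = (\<integral>y. G y \<partial>distr P (Pi\<^sub>M K (\<lambda>_. borel)) (\<lambda>\<omega>. \<lambda>t\<in>K. X' t \<omega>))"
    using fdd K by (simp add: same_fdd_def)
  also have "\<dots> = (\<integral>\<omega>. G (\<lambda>t\<in>K. X' t \<omega>) \<partial>P)"
    by (subst integral_distr) auto
  finally show ?thesis .
qed

definition riemann_average :: "(real \<Rightarrow> real) \<Rightarrow> real \<Rightarrow> real \<Rightarrow> real \<Rightarrow> nat \<Rightarrow> real" where
  "riemann_average f x t \<epsilon> N =
     (\<Sum>k\<le>nat \<lfloor>real (Suc N) * t\<rfloor>. grid_weight N t k * tent ((f (real k / real (Suc N)) - x) / \<epsilon>)) / \<epsilon>"

lemma riemann_average_tendsto: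
  assumes "continuous_on {0..} f"
  shows "(\<lambda>N. riemann_average f x t \<epsilon> N) \<longlonglongrightarrow> occupation_average f x t \<epsilon>"
  unfolding riemann_average_def occupation_average_def divide_inverse[of _ \<epsilon>]
  by (intro tendsto_mult_right riemann_sum_tendsto[where C=1] continuous_intros assms)
    (simp add: tent_nonneg tent_le_1)

context continuous_process_local_time
begin

lemma riemann_average_measurable: "(\<lambda>\<omega>. riemann_average (\<lambda>s. X s \<omega>) x t \<epsilon> N) \<in> borel_measurable P"
proof -
  have [measurable]: "X (real k / real (Suc N)) \<in> borel_measurable P" for k by (rule X_measurable) simp
  show ?thesis unfolding riemann_average_def by measurable
qed

lemma occupation_average_measurable: "(\<lambda>\<omega>. occupation_average (\<lambda>s. X s \<omega>) x t \<epsilon>) \<in> borel_measurable P"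
  by (rule borel_measurable_LIMSEQ_real[where u="\<lambda>N \<omega>. riemann_average (\<lambda>s. X s \<omega>) x t \<epsilon> N"])
   (auto intro!: riemann_average_tendsto continuous_paths riemann_average_measurable)

lemma char_occupation_average_limit:
  "(\<lambda>N. CLINT \<omega>|P. iexp (\<Sum>t\<in>J. c t * riemann_average (\<lambda>s. X s \<omega>) x t \<epsilon> N))
    \<longlonglongrightarrow> (CLINT \<omega>|P. iexp (\<Sum>t\<in>J. c t * occupation_average (\<lambda>s. X s \<omega>) x t \<epsilon>))"
proof (rule integral_dominated_convergence[where w="\<lambda>_. 1"])
  note [measurable] = riemann_average_measurable occupation_average_measurable
  show "(\<lambda>\<omega>. iexp (\<Sum>t\<in>J. c t * occupation_average (\<lambda>s. X s \<omega>) x t \<epsilon>)) \<in> borel_measurable P"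
    by measurable
  show "(\<lambda>\<omega>. iexp (\<Sum>t\<in>J. c t * riemann_average (\<lambda>s. X s \<omega>) x t \<epsilon> N)) \<in> borel_measurable P" for N
    by measurable
  show "AE \<omega> in P. (\<lambda>N. iexp (\<Sum>t\<in>J. c t * riemann_average (\<lambda>s. X s \<omega>) x t \<epsilon> N))
      \<longlonglongrightarrow> iexp (\<Sum>t\<in>J. c t * occupation_average (\<lambda>s. X s \<omega>) x t \<epsilon>)"
    by (intro AE_I2 tendsto_intros riemann_average_tendsto continuous_paths)
qed (auto simp del: of_real_sum)

lemma char_local_time_limit:
  assumes J: "J \<subseteq> {0..}" 
  shows "(\<lambda>n. CLINT \<omega>|P. iexp (\<Sum>t\<in>J. c t * occupation_average (\<lambda>s. X s \<omega>) x t (inverse (real (Suc n)))))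
    \<longlonglongrightarrow> (CLINT \<omega>|P. iexp (\<Sum>t\<in>J. c t * l x t \<omega>))"
proof (rule integral_dominated_convergence[where w="\<lambda>_. 1"])
  note [measurable] = occupation_average_measurable
  have [measurable]: "(\<lambda>\<omega>. \<Sum>t\<in>J. c t * l x t \<omega>) \<in> borel_measurable P"
    using J by (intro borel_measurable_sum borel_measurable_times l_measurable) auto
  show "(\<lambda>\<omega>. iexp (\<Sum>t\<in>J. c t * l x t \<omega>)) \<in> borel_measurable P"
    by measurable
  show "(\<lambda>\<omega>. iexp (\<Sum>t\<in>J. c t * occupation_average (\<lambda>s. X s \<omega>) x t (inverse (real (Suc n))))) \<in> borel_measurable P" for n
    by measurable
  have "filterlim (\<lambda>n. inverse (real (Suc n))) (at_right 0) sequentially"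
    unfolding filterlim_at using LIMSEQ_inverse_real_of_nat by auto
  then have lim: "(\<lambda>n. F (inverse (real (Suc n)))) \<longlonglongrightarrow> y" if "(F \<longlongrightarrow> y) (at_right 0)" for F and y :: real
    by (rule filterlim_compose[OF that])
  show "AE \<omega> in P. (\<lambda>n. iexp (\<Sum>t\<in>J. c t * occupation_average (\<lambda>s. X s \<omega>) x t (inverse (real (Suc n)))))
      \<longlonglongrightarrow> iexp (\<Sum>t\<in>J. c t * l x t \<omega>)"
    using averages
  proof eventually_elim
    case (elim \<omega>)
    then show ?case using J by (intro tendsto_intros lim) auto
  qed
qed (auto simp del: of_real_sum)

end

text \<open>Riemann averages are functions of finitely many values of the process, so their joint laws agree.
  Characteristic functions pass to the limit of a fine grid and then of a narrow tent.\<close>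

lemma local_time_law_cong:
  assumes "continuous_process_local_time P X l" and "continuous_process_local_time P X' l'"
    and fdd: "same_fdd P X X'" and J: "finite J" "J \<subseteq> {0..}"
  shows "distr P borel (\<lambda>\<omega>. \<Sum>t\<in>J. c t * l x t \<omega>) = distr P borel (\<lambda>\<omega>. \<Sum>t\<in>J. c t * l' x t \<omega>)"
proof -
  interpret X: continuous_process_local_time P X l by fact
  interpret X': continuous_process_local_time P X' l' by fact
  have [measurable]: "(\<lambda>\<omega>. \<Sum>t\<in>J. c t * l x t \<omega>) \<in> borel_measurable P" "(\<lambda>\<omega>. \<Sum>t\<in>J. c t * l' x t \<omega>) \<in> borel_measurable P"
    using J by (auto intro!: borel_measurable_sum borel_measurable_times X.l_measurable X'.l_measurable)
  have riemann: "(CLINT \<omega>|P. iexp (\<Sum>t\<in>J. c t * riemann_average (\<lambda>s. X s \<omega>) x t \<epsilon> N)) =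
      (CLINT \<omega>|P. iexp (\<Sum>t\<in>J. c t * riemann_average (\<lambda>s. X' s \<omega>) x t \<epsilon> N))" for \<epsilon> N c
  proof -
    define K where "K = (\<Union>t\<in>J. (\<lambda>k. real k / real (Suc N)) ` {..nat \<lfloor>real (Suc N) * t\<rfloor>})"
    have K: "finite K" "K \<subseteq> {0..}" using J by (auto simp: K_def)
    have [measurable]: "(\<lambda>y. riemann_average y x t \<epsilon> N) \<in> borel_measurable (Pi\<^sub>M K (\<lambda>_. borel))" if "t \<in> J" for t
      unfolding riemann_average_def
    proof (intro borel_measurable_divide borel_measurable_sum borel_measurable_times borel_measurable_const)
      fix k assume "k \<in> {..nat \<lfloor>real (Suc N) * t\<rfloor>}"
      then have "real k / real (Suc N) \<in> K" using that by (auto simp: K_def)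
      then have [measurable]: "(\<lambda>y. y (real k / real (Suc N))) \<in> borel_measurable (Pi\<^sub>M K (\<lambda>_. borel))"
        by (rule measurable_component_singleton)
      show "(\<lambda>y. tent ((y (real k / real (Suc N)) - x) / \<epsilon>)) \<in> borel_measurable (Pi\<^sub>M K (\<lambda>_. borel))"
        by measurable
    qed
    have restr: "riemann_average (\<lambda>t\<in>K. f t) x t \<epsilon> N = riemann_average f x t \<epsilon> N" if "t \<in> J" for f t
    proof -
      have "real k / real (Suc N) \<in> K" if "k \<le> nat \<lfloor>real (Suc N) * t\<rfloor>" for k
        unfolding K_def using \<open>t \<in> J\<close> that by blast
      then show ?thesis
        unfolding riemann_average_def by (intro arg_cong[where f="\<lambda>a. a / \<epsilon>"] sum.cong refl) simp
    qed
    have "(CLINT \<omega>|P. iexp (\<Sum>t\<in>J. c t * riemann_average (\<lambda>t\<in>K. X t \<omega>) x t \<epsilon> N)) =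
      (CLINT \<omega>|P. iexp (\<Sum>t\<in>J. c t * riemann_average (\<lambda>t\<in>K. X' t \<omega>) x t \<epsilon> N))"
      by (rule same_fdd_integral_eq[OF fdd K X.X_measurable X'.X_measurable]) measurable
    then show ?thesis by (simp add: restr cong: sum.cong)
  qed
  have average: "(CLINT \<omega>|P. iexp (\<Sum>t\<in>J. c t * occupation_average (\<lambda>s. X s \<omega>) x t \<epsilon>)) =
      (CLINT \<omega>|P. iexp (\<Sum>t\<in>J. c t * occupation_average (\<lambda>s. X' s \<omega>) x t \<epsilon>))" for \<epsilon> c
    using X.char_occupation_average_limit[of c x \<epsilon> J] X'.char_occupation_average_limit[of c x \<epsilon> J]
    unfolding riemann by (rule LIMSEQ_unique)
  have local_time: "(CLINT \<omega>|P. iexp (\<Sum>t\<in>J. c t * l x t \<omega>)) = (CLINT \<omega>|P. iexp (\<Sum>t\<in>J. c t * l' x t \<omega>))" for c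
    using X.char_local_time_limit[OF J(2), of c x] X'.char_local_time_limit[OF J(2), of c x]
    unfolding average by (rule LIMSEQ_unique)
  show ?thesis
  proof (rule Levy_uniqueness)
    show "char (distr P borel (\<lambda>\<omega>. \<Sum>t\<in>J. c t * l x t \<omega>)) = char (distr P borel (\<lambda>\<omega>. \<Sum>t\<in>J. c t * l' x t \<omega>))"
    proof
      fix \<theta>
      show "char (distr P borel (\<lambda>\<omega>. \<Sum>t\<in>J. c t * l x t \<omega>)) \<theta> = char (distr P borel (\<lambda>\<omega>. \<Sum>t\<in>J. c t * l' x t \<omega>)) \<theta>"
        using local_time[of "\<lambda>t. \<theta> * c t"]
        by (simp add: char_def integral_distr sum_distrib_left mult.assoc del: of_real_sum of_real_mult)
    qed
  qed auto
qed

section \<open>Integrability of the local time of fractional Brownian motion\<close>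

text \<open>After rounding the second argument to a grid there are countably many pieces, and on each of them
  the function depends measurably on the first argument alone; continuity removes the rounding.\<close>

lemma caratheodory_measurable:
  fixes f :: "'a \<Rightarrow> real \<Rightarrow> real"
  assumes meas: "\<And>x. (\<lambda>\<omega>. f \<omega> x) \<in> borel_measurable P"
    and cont: "\<And>\<omega>. \<omega> \<in> space P \<Longrightarrow> continuous_on UNIV (f \<omega>)"
  shows "(\<lambda>p. f (fst p) (snd p)) \<in> borel_measurable (P \<Otimes>\<^sub>M borel)"
proof (rule borel_measurable_LIMSEQ_real)
  fix p assume "p \<in> space (P \<Otimes>\<^sub>M (borel :: real measure))"
  then have "continuous_on UNIV (f (fst p))" by (intro cont) (auto simp: space_pair_measure)
  then show "(\<lambda>N. f (fst p) (real_of_int \<lfloor>real (Suc N) * snd p\<rfloor> / real (Suc N))) \<longlonglongrightarrow> f (fst p) (snd p)"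
    by (rule continuous_on_tendsto_compose[OF _ floor_grid_tendsto]) auto
next
  fix N
  note [measurable] = meas
  show "(\<lambda>p. f (fst p) (real_of_int \<lfloor>real (Suc N) * snd p\<rfloor> / real (Suc N))) \<in> borel_measurable (P \<Otimes>\<^sub>M borel)"
    by (rule measurable_compose_countable[where f="\<lambda>i p. f (fst p) (real_of_int i / real (Suc N))"
        and g="\<lambda>p. \<lfloor>real (Suc N) * snd p\<rfloor>"]) measurable
qed

text \<open>The density of a centered normal law is at most \<open>1/\<bar>\<sigma>\<bar>\<close> and the rescaled tent has mass one.\<close>

lemma normal_expectation_tent_le:
  assumes \<sigma>: "\<sigma> \<noteq> 0" and \<epsilon>: "0 < \<epsilon>"
  shows "(\<integral>\<^sup>+z. ennreal (tent (\<sigma> * z / \<epsilon>) / \<epsilon>) \<partial>std_normal_distribution) \<le> ennreal (1 / \<bar>\<sigma>\<bar>)"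
proof -
  have dens: "std_normal_density z \<le> 1" for z
  proof -
    have "1 \<le> sqrt (2 * pi)" using pi_ge_two by simp
    then have "1 / sqrt (2 * pi) * exp (- z\<^sup>2 / 2) \<le> 1 * 1" by (intro mult_mono) auto
    then show ?thesis by (simp add: std_normal_density_def)
  qed
  have tent1: "(\<integral>\<^sup>+z. ennreal (tent z) \<partial>lborel) = 1"
    using integrable_tent_mult[of "\<lambda>_. 1"] by (subst nn_integral_eq_integral) (auto simp: tent_nonneg integral_tent)
  have "(\<integral>\<^sup>+z. ennreal (tent (\<sigma> * z / \<epsilon>) / \<epsilon>) \<partial>std_normal_distribution) =
      (\<integral>\<^sup>+z. ennreal (std_normal_density z) * ennreal (tent (\<sigma> * z / \<epsilon>) / \<epsilon>) \<partial>lborel)"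
    by (subst nn_integral_density) auto
  also have "\<dots> \<le> (\<integral>\<^sup>+z. 1 * ennreal (tent (\<sigma> * z / \<epsilon>) / \<epsilon>) \<partial>lborel)"
    using dens by (intro nn_integral_mono mult_right_mono) (auto simp flip: ennreal_1 intro!: ennreal_leI)
  also have "\<dots> = (\<integral>\<^sup>+z. ennreal (1 / \<bar>\<sigma>\<bar>) * (ennreal \<bar>\<sigma> / \<epsilon>\<bar> * ennreal (tent (0 + \<sigma> / \<epsilon> * z))) \<partial>lborel)"
    using \<sigma> \<epsilon> by (intro nn_integral_cong) (simp add: ennreal_mult[symmetric] tent_nonneg)
  also have "\<dots> = ennreal (1 / \<bar>\<sigma>\<bar>) * (ennreal \<bar>\<sigma> / \<epsilon>\<bar> * (\<integral>\<^sup>+z. ennreal (tent (0 + \<sigma> / \<epsilon> * z)) \<partial>lborel))"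
    by (subst nn_integral_cmult, measurable)+
  also have "ennreal \<bar>\<sigma> / \<epsilon>\<bar> * (\<integral>\<^sup>+z. ennreal (tent (0 + \<sigma> / \<epsilon> * z)) \<partial>lborel) = 1"
    using nn_integral_real_affine[of "\<lambda>z. ennreal (tent z)" "\<sigma> / \<epsilon>" 0] \<sigma> \<epsilon> tent1 by simp
  finally show ?thesis by simp
qed

lemma nn_integral_abs_powr_finite:
  fixes H t :: real
  assumes H: "H < 1" and t: "0 \<le> t"
  shows "(\<integral>\<^sup>+v. ennreal (indicator {-t..t} v * \<bar>v\<bar> powr (- H)) \<partial>lborel) < \<infinity>"
proof -
  let ?f = "\<lambda>v. indicator {0..t} v * v powr (- H) :: real"
  have "((\<lambda>v. v powr (- H)) has_integral (t powr (- H + 1) / (- H + 1))) {0..t}"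
    by (rule has_integral_powr_from_0) (use H t in auto)
  then have "((\<lambda>v. if v \<in> {0..t} then v powr (- H) else 0) has_integral (t powr (- H + 1) / (- H + 1))) UNIV"
    by (simp only: has_integral_restrict_UNIV)
  also have "(\<lambda>v. if v \<in> {0..t} then v powr (- H) else 0) = ?f"
    by (auto simp: indicator_def)
  finally have "(\<integral>\<^sup>+v. ennreal (?f v) \<partial>lborel) = ennreal (t powr (- H + 1) / (- H + 1))"
    by (intro nn_integral_has_integral_lborel) auto
  then have fin: "(\<integral>\<^sup>+v. ennreal (?f v) \<partial>lborel) < \<infinity>" by simp
  have "(\<integral>\<^sup>+v. ennreal (indicator {-t..t} v * \<bar>v\<bar> powr (- H)) \<partial>lborel) \<le>
      (\<integral>\<^sup>+v. ennreal (?f v) + ennreal (?f (0 + (-1) * v)) \<partial>lborel)"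
    by (intro nn_integral_mono) (auto simp: indicator_def abs_if)
  also have "\<dots> = (\<integral>\<^sup>+v. ennreal (?f v) \<partial>lborel) + (\<integral>\<^sup>+v. ennreal (?f (0 + (-1) * v)) \<partial>lborel)"
    by (rule nn_integral_add) measurable
  also have "(\<integral>\<^sup>+v. ennreal (?f (0 + (-1) * v)) \<partial>lborel) = (\<integral>\<^sup>+v. ennreal (?f v) \<partial>lborel)"
    using nn_integral_real_affine[of "\<lambda>v. ennreal (?f v)" "-1" 0] by simp
  also have "(\<integral>\<^sup>+v. ennreal (?f v) \<partial>lborel) + (\<integral>\<^sup>+v. ennreal (?f v) \<partial>lborel) < \<infinity>"
    using fin by simp
  finally show ?thesis .
qed

text \<open>For \<open>y \<ge> 1\<close> the square dominates as \<open>\<alpha> < 2\<close>. Below \<open>1\<close> the weight \<open>(1+x\<^sup>2)\<^sup>k\<close> separates two cases: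
  either it lifts \<open>y\<close> above \<open>1\<close>, or \<open>y\<close> is so small that its power is integrable over the line.\<close>

lemma powr_le_weighted:
  fixes y x \<alpha> :: real
  assumes y: "0 \<le> y" and \<alpha>: "0 < \<alpha>" "\<alpha> < 2" and k: "1 \<le> real k * \<alpha>"
  shows "y powr \<alpha> \<le> y\<^sup>2 + (1 + x\<^sup>2) ^ k * y + inverse (1 + x\<^sup>2)"
proof -
  have w: "1 \<le> 1 + x\<^sup>2" by simp
  have wk: "0 < (1 + x\<^sup>2) ^ k" by (intro zero_less_power) (use w in linarith)
  consider "1 \<le> y" | "y < 1" "inverse ((1 + x\<^sup>2) ^ k) \<le> y" | "y < inverse ((1 + x\<^sup>2) ^ k)"
    by linarith
  then show ?thesis
  proof cases
    case 1
    then have "y powr \<alpha> \<le> y powr 2" using \<alpha> by (intro powr_mono) auto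
    also have "\<dots> = y\<^sup>2" using 1 by (simp add: powr_numeral)
    finally show ?thesis using y wk w by (simp add: add_increasing2)
  next
    case 2
    have "y powr \<alpha> \<le> 1 powr \<alpha>" using 2 y \<alpha> by (intro powr_mono2) auto
    also have "\<dots> = (1 + x\<^sup>2) ^ k * inverse ((1 + x\<^sup>2) ^ k)"
      unfolding powr_one_eq_one by (rule right_inverse[symmetric]) (use wk in linarith)
    also have "\<dots> \<le> (1 + x\<^sup>2) ^ k * y" using 2 wk by (intro mult_left_mono) auto
    finally show ?thesis using y w by (simp add: add_increasing add_increasing2)
  next
    case 3
    have "y powr \<alpha> \<le> inverse ((1 + x\<^sup>2) ^ k) powr \<alpha>" using 3 y \<alpha> by (intro powr_mono2) auto
    also have "\<dots> = (1 + x\<^sup>2) powr (- (real k * \<alpha>))"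
    proof -
      have "0 < 1 + x\<^sup>2" using w by linarith
      then have "inverse ((1 + x\<^sup>2) ^ k) = (1 + x\<^sup>2) powr (- real k)"
        by (simp only: powr_minus powr_realpow)
      then show ?thesis by (simp only: powr_powr mult_minus_left)
    qed
    also have "\<dots> \<le> (1 + x\<^sup>2) powr (- 1)"
      using w k by (intro powr_mono) auto
    also have "\<dots> = inverse (1 + x\<^sup>2)" using w by (simp add: powr_minus)
    finally show ?thesis using y wk by (simp add: add_increasing)
  qed
qed

lemma nn_integral_inverse_1_plus_square: "(\<integral>\<^sup>+x. ennreal (inverse (1 + x\<^sup>2)) \<partial>lborel) < \<infinity>"
  using integrable_inverse_1_plus_square
  by (simp add: set_integrable_def integrable_iff_bounded)

locale fBm_local_time =
  fractional_Brownian_motion P H B + jointly_continuous_local_time P B l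
  for P :: "'a measure" and H B l
begin

lemma V_sqrt: "0 < sqrt V" using variance_pos by simp

text \<open>Paths are continuous on the half-line only; \<open>max 0\<close> extends them continuously to all times.\<close>

lemma path_measurable[measurable (raw)]:
  assumes [measurable]: "f \<in> N \<rightarrow>\<^sub>M P" "g \<in> borel_measurable N"
  shows "(\<lambda>y. B (max 0 (g y)) (f y)) \<in> borel_measurable N"
proof -
  have "(\<lambda>p. B (max 0 (snd p)) (fst p)) \<in> borel_measurable (P \<Otimes>\<^sub>M borel)"
    by (rule caratheodory_measurable[where f="\<lambda>\<omega> s. B (max 0 s) \<omega>"])
      (auto intro!: measurable_value continuous_on_compose2[OF continuous_paths] continuous_intros)
  then have "(\<lambda>y. (\<lambda>p. B (max 0 (snd p)) (fst p)) (f y, g y)) \<in> borel_measurable N"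
    by (rule measurable_compose[rotated]) measurable
  then show ?thesis by simp
qed

lemma local_time_continuous:
  "\<omega> \<in> space P \<Longrightarrow> 0 \<le> t \<Longrightarrow> continuous_on UNIV (\<lambda>x. l x t \<omega>)"
  using continuous_on_compose2[OF jointly_continuous, of \<omega> UNIV "\<lambda>x. (x, t)"]
  by (simp add: continuous_on_Pair image_subset_iff)

lemma local_time_measurable[measurable (raw)]:
  assumes t: "0 \<le> t" and [measurable]: "f \<in> N \<rightarrow>\<^sub>M P" "g \<in> borel_measurable N"
  shows "(\<lambda>y. l (g y) t (f y)) \<in> borel_measurable N"
proof -
  have "(\<lambda>p. l (snd p) t (fst p)) \<in> borel_measurable (P \<Otimes>\<^sub>M borel)"
    by (rule caratheodory_measurable[where f="\<lambda>\<omega> x. l x t \<omega>"])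
      (auto intro!: measurable local_time_continuous t)
  then have "(\<lambda>y. (\<lambda>p. l (snd p) t (fst p)) (f y, g y)) \<in> borel_measurable N"
    by (rule measurable_compose[rotated]) measurable
  then show ?thesis by simp
qed

lemma nn_integral_marginal:
  assumes X: "gaussian_rv P X" "expectation X = 0" and g[measurable]: "g \<in> borel_measurable borel"
  obtains \<sigma> where "\<sigma>\<^sup>2 = expectation (\<lambda>\<omega>. (X \<omega>)\<^sup>2)"
    "(\<integral>\<^sup>+\<omega>. g (X \<omega>) \<partial>P) = (\<integral>\<^sup>+z. g (\<sigma> * z) \<partial>std_normal_distribution)"
proof -
  obtain \<sigma> where [measurable]: "X \<in> borel_measurable P"
    and law: "distr P borel X = distr std_normal_distribution borel (\<lambda>z. \<sigma> * z)"
    and var: "expectation (\<lambda>\<omega>. (X \<omega>)\<^sup>2) = \<sigma>\<^sup>2"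
    using gaussian_rv_centered[OF prob_space_axioms X] by metis
  have "(\<integral>\<^sup>+\<omega>. g (X \<omega>) \<partial>P) = (\<integral>\<^sup>+x. g x \<partial>distr P borel X)"
    by (subst nn_integral_distr) auto
  also have "\<dots> = (\<integral>\<^sup>+z. g (\<sigma> * z) \<partial>std_normal_distribution)"
    unfolding law by (subst nn_integral_distr) auto
  finally show thesis using that var by simp
qed

text \<open>The increment has standard deviation \<open>sqrt V * \<bar>u - s\<bar> powr H\<close>.\<close>

lemma increment_tent_le:
  assumes s: "0 \<le> s" and u: "0 \<le> u" and su: "s \<noteq> u" and \<epsilon>: "0 < \<epsilon>"
  shows "(\<integral>\<^sup>+\<omega>. ennreal (tent ((B u \<omega> - B s \<omega>) / \<epsilon>) / \<epsilon>) \<partial>P) \<le> ennreal (\<bar>u - s\<bar> powr (- H) / sqrt V)"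
  using s u su
proof (induction s u rule: linorder_wlog)
  case (sym u s)
  have "tent ((B u \<omega> - B s \<omega>) / \<epsilon>) = tent ((B s \<omega> - B u \<omega>) / \<epsilon>)" for \<omega>
    unfolding tent_def by (simp add: abs_minus_commute)
  with sym show ?case by (simp add: abs_minus_commute)
next
  case (le s u)
  interpret inc: centered_gaussian_process P "\<lambda>t \<omega>. B (t + s) \<omega> - B s \<omega>"
    by (rule increments_gaussian) fact
  obtain \<sigma> where \<sigma>: "\<sigma>\<^sup>2 = expectation (\<lambda>\<omega>. (B ((u - s) + s) \<omega> - B s \<omega>)\<^sup>2)"
    and eq: "(\<integral>\<^sup>+\<omega>. ennreal (tent ((B ((u - s) + s) \<omega> - B s \<omega>) / \<epsilon>) / \<epsilon>) \<partial>P) =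
      (\<integral>\<^sup>+z. ennreal (tent (\<sigma> * z / \<epsilon>) / \<epsilon>) \<partial>std_normal_distribution)"
    by (rule nn_integral_marginal[of "\<lambda>\<omega>. B ((u - s) + s) \<omega> - B s \<omega>" "\<lambda>y. ennreal (tent (y / \<epsilon>) / \<epsilon>)"])
      (use le inc.gaussian_rv_value[of "u - s"] inc.mean[of "u - s"] in auto)
  have "\<sigma>\<^sup>2 = V * (u - s) powr (2 * H)"
    using expectation_increments_product[of s "u - s" "u - s"] expectation_square[of "u - s"] le
    unfolding \<sigma> by (simp add: power2_eq_square)
  then have "\<bar>\<sigma>\<bar> = sqrt V * (u - s) powr H"
    using le by (simp add: real_sqrt_mult powr_half_sqrt[symmetric] powr_powr flip: real_sqrt_abs)
  moreover from this have "\<sigma> \<noteq> 0" using V_sqrt le by auto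
  ultimately show ?case
    using normal_expectation_tent_le[of \<sigma> \<epsilon>] \<epsilon> eq le by (simp add: powr_minus divide_inverse mult_ac)
qed

text \<open>By the occupation formula the inner integral is \<open>\<integral>\<^sub>0\<^sup>t (1 + B(s)\<^sup>2)\<^sup>k ds\<close>, and the Gaussian moments are
  largest at \<open>s = t\<close>.\<close>

lemma local_time_weighted_integral_finite:
  assumes t: "0 \<le> t"
  shows "(\<integral>\<^sup>+\<omega>. (\<integral>\<^sup>+x. ennreal ((1 + x\<^sup>2) ^ k * l x t \<omega>) \<partial>lborel) \<partial>P) < \<infinity>"
proof -
  interpret PL: pair_sigma_finite P lborel by unfold_locales
  define A where "A = V * t powr (2 * H)"
  define C where "C = (\<integral>\<^sup>+z. ennreal ((1 + A * z\<^sup>2) ^ k) \<partial>std_normal_distribution)"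
  have A: "0 \<le> A" unfolding A_def by (intro mult_nonneg_nonneg) auto
  have "integrable std_normal_distribution (\<lambda>z. (A * z\<^sup>2 + 1) ^ k)"
    unfolding binomial_ring
    by (intro Bochner_Integration.integrable_sum)
      (auto simp: power_mult_distrib simp flip: power_mult intro!: integrable_std_normal_distribution_moment)
  then have C: "C < \<infinity>"
    unfolding C_def using A by (simp add: integrable_iff_bounded add.commute zero_le_power)
  have "(\<integral>\<^sup>+\<omega>. (\<integral>\<^sup>+x. ennreal ((1 + x\<^sup>2) ^ k * l x t \<omega>) \<partial>lborel) \<partial>P) =
      (\<integral>\<^sup>+\<omega>. (\<integral>\<^sup>+s. ennreal ((1 + (B (max 0 s) \<omega>)\<^sup>2) ^ k) * indicator {0..t} s \<partial>lborel) \<partial>P)"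
  proof (rule nn_integral_cong_AE, use occupation nonneg in eventually_elim)
    case (elim \<omega>)
    have "(\<integral>\<^sup>+x. ennreal ((1 + x\<^sup>2) ^ k * l x t \<omega>) \<partial>lborel) = (\<integral>\<^sup>+x. ennreal ((1 + x\<^sup>2) ^ k) * ennreal (l x t \<omega>) \<partial>lborel)"
      using elim t by (intro nn_integral_cong) (simp add: ennreal_mult)
    also have "\<dots> = (\<integral>\<^sup>+s\<in>{0..t}. ennreal ((1 + (B s \<omega>)\<^sup>2) ^ k) \<partial>lborel)"
      using elim t by (intro elim(1)[rule_format, symmetric]) measurable
    also have "\<dots> = (\<integral>\<^sup>+s. ennreal ((1 + (B (max 0 s) \<omega>)\<^sup>2) ^ k) * indicator {0..t} s \<partial>lborel)"
      by (intro nn_integral_cong) (auto simp: indicator_def max_def)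
    finally show ?case .
  qed
  also have "\<dots> = (\<integral>\<^sup>+s. (\<integral>\<^sup>+\<omega>. ennreal ((1 + (B (max 0 s) \<omega>)\<^sup>2) ^ k) * indicator {0..t} s \<partial>P) \<partial>lborel)"
    by (rule PL.Fubini'[symmetric]) measurable
  also have "\<dots> \<le> (\<integral>\<^sup>+s. C * indicator {0..t} s \<partial>lborel)"
  proof (rule nn_integral_mono)
    fix s
    have "(\<integral>\<^sup>+\<omega>. ennreal ((1 + (B s \<omega>)\<^sup>2) ^ k) \<partial>P) \<le> C" if s: "s \<in> {0..t}"
    proof -
      obtain \<sigma> where \<sigma>: "\<sigma>\<^sup>2 = expectation (\<lambda>\<omega>. (B s \<omega>)\<^sup>2)"
        and eq: "(\<integral>\<^sup>+\<omega>. ennreal ((1 + (B s \<omega>)\<^sup>2) ^ k) \<partial>P) = (\<integral>\<^sup>+z. ennreal ((1 + (\<sigma> * z)\<^sup>2) ^ k) \<partial>std_normal_distribution)"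
        by (rule nn_integral_marginal[of "B s" "\<lambda>y. ennreal ((1 + y\<^sup>2) ^ k)"])
          (use s gaussian_rv_value mean in auto)
      have "\<sigma>\<^sup>2 \<le> A"
        unfolding \<sigma> A_def using s H_pos variance_pos
        by (subst expectation_square) (auto intro!: mult_left_mono powr_mono2)
      then show ?thesis
        unfolding eq C_def by (intro nn_integral_mono ennreal_leI power_mono add_left_mono)
          (auto simp: power_mult_distrib intro!: mult_right_mono)
    qed
    then show "(\<integral>\<^sup>+\<omega>. ennreal ((1 + (B (max 0 s) \<omega>)\<^sup>2) ^ k) * indicator {0..t} s \<partial>P) \<le> C * indicator {0..t} s"
      by (cases "s \<in> {0..t}") auto
  qed
  also have "\<dots> = C * ennreal t"
    using t by (simp add: nn_integral_cmult_indicator)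
  also have "\<dots> < \<infinity>" using C by (simp add: ennreal_mult_less_top)
  finally show ?thesis .
qed

text \<open>Formally \<open>\<integral> l(x,t)\<^sup>2 dx = \<integral>\<integral> \<delta>(B(u) - B(s)) ds du\<close>. The occupation formula with \<open>g = l(\<cdot>,t)\<close> gives
  \<open>\<integral> l(B(s),t) ds\<close>, the local time at the level \<open>B(s)\<close> is a limit of occupation averages, and Fatou's
  lemma moves the limit out of the time integral.\<close>

lemma local_time_square_integral_le_liminf:
  fixes \<epsilon> :: "nat \<Rightarrow> real"
  assumes t: "0 \<le> t" and \<epsilon>: "\<And>n. 0 < \<epsilon> n" "\<epsilon> \<longlonglongrightarrow> 0"
  defines "G \<equiv> \<lambda>n \<omega> s u. ennreal (tent ((B (max 0 u) \<omega> - B (max 0 s) \<omega>) / \<epsilon> n) / \<epsilon> n) * indicator {0..t} u * indicator {0..t} s"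
  shows "AE \<omega> in P. (\<integral>\<^sup>+x. ennreal ((l x t \<omega>)\<^sup>2) \<partial>lborel) \<le> liminf (\<lambda>n. \<integral>\<^sup>+s. \<integral>\<^sup>+u. G n \<omega> s u \<partial>lborel \<partial>lborel)"
  using occupation nonneg AE_space
proof eventually_elim
  case (elim \<omega>)
  let ?L = "\<lambda>x. l x t \<omega>"
  note cont = local_time_continuous[OF elim(3) t]
  have [measurable]: "?L \<in> borel_measurable borel" by (rule borel_measurable_continuous_onI[OF cont])
  have [measurable]: "(\<lambda>u. B (max 0 u) \<omega>) \<in> borel_measurable borel" using elim(3) by measurable
  have G[measurable]: "(\<lambda>(s, u). G n \<omega> s u) \<in> borel_measurable (borel \<Otimes>\<^sub>M borel)" for n
    unfolding G_def by measurable
  have "(\<integral>\<^sup>+x. ennreal ((?L x)\<^sup>2) \<partial>lborel) = (\<integral>\<^sup>+x. ennreal (?L x) * ennreal (?L x) \<partial>lborel)"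
    using elim(2) t by (intro nn_integral_cong) (simp add: ennreal_mult power2_eq_square)
  also have "\<dots> = (\<integral>\<^sup>+s\<in>{0..t}. ennreal (?L (B s \<omega>)) \<partial>lborel)"
    using elim t by (intro elim(1)[rule_format, symmetric]) measurable
  also have "\<dots> \<le> (\<integral>\<^sup>+s. liminf (\<lambda>n. \<integral>\<^sup>+u. G n \<omega> s u \<partial>lborel) \<partial>lborel)"
  proof (rule nn_integral_mono)
    fix s
    show "ennreal (?L (B s \<omega>)) * indicator {0..t} s \<le> liminf (\<lambda>n. \<integral>\<^sup>+u. G n \<omega> s u \<partial>lborel)"
    proof (cases "s \<in> {0..t}")
      case True
      have avg: "(\<integral>\<^sup>+u. G n \<omega> s u \<partial>lborel) = ennreal (occupation_average (\<lambda>u. B u \<omega>) (B s \<omega>) t (\<epsilon> n))" for n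
      proof -
        have "(\<integral>\<^sup>+u. G n \<omega> s u \<partial>lborel) =
          (\<integral>\<^sup>+u. ennreal (indicator {0..t} u *\<^sub>R tent ((B u \<omega> - B s \<omega>) / \<epsilon> n) / \<epsilon> n) \<partial>lborel)"
          using True by (intro nn_integral_cong) (auto simp: G_def indicator_def max_def)
        also have "\<dots> = ennreal (\<integral>u. indicator {0..t} u *\<^sub>R tent ((B u \<omega> - B s \<omega>) / \<epsilon> n) / \<epsilon> n \<partial>lborel)"
          using integrable_tent_path[OF continuous_paths[OF elim(3)], of t "B s \<omega>" "\<epsilon> n"] \<epsilon>(1)[of n]
          by (intro nn_integral_eq_integral) (auto simp: set_integrable_def tent_nonneg)
        finally show ?thesis by (simp add: occupation_average_def set_lebesgue_integral_def)
      qed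
      have "filterlim \<epsilon> (at_right 0) sequentially"
        unfolding filterlim_at using \<epsilon> by (simp add: less_imp_neq[symmetric])
      moreover have "((\<lambda>e. occupation_average (\<lambda>u. B u \<omega>) (B s \<omega>) t e) \<longlongrightarrow> ?L (B s \<omega>)) (at_right 0)"
        using elim t by (intro occupation_average_tendsto[where L="?L"] cont continuous_paths) auto
      ultimately have "(\<lambda>n. occupation_average (\<lambda>u. B u \<omega>) (B s \<omega>) t (\<epsilon> n)) \<longlonglongrightarrow> ?L (B s \<omega>)"
        by (rule filterlim_compose[rotated])
      then have "(\<lambda>n. \<integral>\<^sup>+u. G n \<omega> s u \<partial>lborel) \<longlonglongrightarrow> ennreal (?L (B s \<omega>))"
        unfolding avg by (rule tendsto_ennrealI)
      then have "liminf (\<lambda>n. \<integral>\<^sup>+u. G n \<omega> s u \<partial>lborel) = ennreal (?L (B s \<omega>))"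
        by (rule lim_imp_Liminf[OF sequentially_bot])
      then show ?thesis using True by simp
    qed simp
  qed
  also have "\<dots> \<le> liminf (\<lambda>n. \<integral>\<^sup>+s. \<integral>\<^sup>+u. G n \<omega> s u \<partial>lborel \<partial>lborel)"
    by (rule nn_integral_liminf) measurable
  finally show ?case .
qed

text \<open>Fatou's lemma reduces the claim to the expectations of the mollified double integrals, which are
  bounded uniformly in the width of the tent because \<open>\<bar>u - s\<bar> powr (- H)\<close> is integrable for \<open>H < 1\<close>.\<close>

lemma local_time_square_integral_finite:
  assumes t: "0 \<le> t"
  shows "(\<integral>\<^sup>+\<omega>. (\<integral>\<^sup>+x. ennreal ((l x t \<omega>)\<^sup>2) \<partial>lborel) \<partial>P) < \<infinity>"
proof -
  interpret PL: pair_sigma_finite P lborel by unfold_locales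
  define \<epsilon> where "\<epsilon> n = inverse (real (Suc n))" for n
  have \<epsilon>: "\<And>n. 0 < \<epsilon> n" "\<epsilon> \<longlonglongrightarrow> 0"
    using LIMSEQ_inverse_real_of_nat by (auto simp: \<epsilon>_def[abs_def])
  define G where "G n \<omega> s u = ennreal (tent ((B (max 0 u) \<omega> - B (max 0 s) \<omega>) / \<epsilon> n) / \<epsilon> n) * indicator {0..t} u * indicator {0..t} s"
    for n \<omega> s u
  define K where "K = (\<integral>\<^sup>+v. ennreal (indicator {-t..t} v * \<bar>v\<bar> powr (- H)) \<partial>lborel)"
  have K: "K < \<infinity>" unfolding K_def by (rule nn_integral_abs_powr_finite[OF H_less_1 t])
  define c where "c = ennreal (1 / sqrt V)"
  have bound: "(\<integral>\<^sup>+\<omega>. \<integral>\<^sup>+s. \<integral>\<^sup>+u. G n \<omega> s u \<partial>lborel \<partial>lborel \<partial>P) \<le> c * K * ennreal t" for n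
  proof -
    have "(\<integral>\<^sup>+\<omega>. \<integral>\<^sup>+s. \<integral>\<^sup>+u. G n \<omega> s u \<partial>lborel \<partial>lborel \<partial>P) = (\<integral>\<^sup>+s. \<integral>\<^sup>+\<omega>. \<integral>\<^sup>+u. G n \<omega> s u \<partial>lborel \<partial>P \<partial>lborel)"
      by (rule PL.Fubini'[symmetric]) (unfold G_def, measurable)
    also have "\<dots> = (\<integral>\<^sup>+s. \<integral>\<^sup>+u. \<integral>\<^sup>+\<omega>. G n \<omega> s u \<partial>P \<partial>lborel \<partial>lborel)"
      by (intro nn_integral_cong PL.Fubini'[symmetric]) (unfold G_def, measurable)
    also have "\<dots> \<le> (\<integral>\<^sup>+s. c * K * indicator {0..t} s \<partial>lborel)"
    proof (rule nn_integral_mono)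
      fix s :: real
      show "(\<integral>\<^sup>+u. \<integral>\<^sup>+\<omega>. G n \<omega> s u \<partial>P \<partial>lborel) \<le> c * K * indicator {0..t} s"
      proof (cases "s \<in> {0..t}")
        case True
        have "(\<integral>\<^sup>+u. \<integral>\<^sup>+\<omega>. G n \<omega> s u \<partial>P \<partial>lborel) \<le>
            (\<integral>\<^sup>+u. c * ennreal (indicator {-t..t} (- s + 1 * u) * \<bar>- s + 1 * u\<bar> powr (- H)) \<partial>lborel)"
        (* On the diagonal u = s the increment vanishes and the bound fails, whence the null set. *)
        proof (rule nn_integral_mono_AE, use AE_lborel_singleton[of s] in eventually_elim)
          case (elim u)
          show ?case
          proof (cases "u \<in> {0..t}")
            case u: True
            have "(\<integral>\<^sup>+\<omega>. G n \<omega> s u \<partial>P) = (\<integral>\<^sup>+\<omega>. ennreal (tent ((B u \<omega> - B s \<omega>) / \<epsilon> n) / \<epsilon> n) \<partial>P)"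
              using u True by (simp add: G_def max_def)
            also have "\<dots> \<le> ennreal (\<bar>u - s\<bar> powr (- H) / sqrt V)"
              using u True elim by (intro increment_tent_le \<epsilon>) auto
            also have "\<dots> = c * ennreal (indicator {-t..t} (- s + 1 * u) * \<bar>- s + 1 * u\<bar> powr (- H))"
              using u True V_sqrt by (simp add: c_def ennreal_mult[symmetric])
            finally show ?thesis .
          qed (simp add: G_def)
        qed
        also have "\<dots> = c * (\<integral>\<^sup>+u. ennreal (indicator {-t..t} (- s + 1 * u) * \<bar>- s + 1 * u\<bar> powr (- H)) \<partial>lborel)"
          by (rule nn_integral_cmult) measurable
        also have "(\<integral>\<^sup>+u. ennreal (indicator {-t..t} (- s + 1 * u) * \<bar>- s + 1 * u\<bar> powr (- H)) \<partial>lborel) = K"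
          using nn_integral_real_affine[of "\<lambda>v. ennreal (indicator {-t..t} v * \<bar>v\<bar> powr (- H))" 1 "- s"]
          by (simp add: K_def)
        finally show ?thesis using True by simp
      qed (simp add: G_def)
    qed
    also have "\<dots> = c * K * ennreal t" using t by (simp add: nn_integral_cmult_indicator)
    finally show ?thesis .
  qed
  have "(\<integral>\<^sup>+\<omega>. (\<integral>\<^sup>+x. ennreal ((l x t \<omega>)\<^sup>2) \<partial>lborel) \<partial>P) \<le>
      (\<integral>\<^sup>+\<omega>. liminf (\<lambda>n. \<integral>\<^sup>+s. \<integral>\<^sup>+u. G n \<omega> s u \<partial>lborel \<partial>lborel) \<partial>P)"
    unfolding G_def by (intro nn_integral_mono_AE local_time_square_integral_le_liminf t \<epsilon>)
  also have "\<dots> \<le> liminf (\<lambda>n. \<integral>\<^sup>+\<omega>. \<integral>\<^sup>+s. \<integral>\<^sup>+u. G n \<omega> s u \<partial>lborel \<partial>lborel \<partial>P)"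
    by (rule nn_integral_liminf) (unfold G_def, measurable)
  also have "\<dots> \<le> liminf (\<lambda>n. c * K * ennreal t)"
    by (intro Liminf_mono always_eventually allI bound)
  also have "\<dots> = c * K * ennreal t" by (simp add: Liminf_const)
  also have "\<dots> < \<infinity>" using K by (simp add: c_def ennreal_mult_less_top)
  finally show ?thesis .
qed

lemma L_space_iff:
  assumes [measurable]: "(\<lambda>(\<omega>, x). f \<omega> x) \<in> borel_measurable (P \<Otimes>\<^sub>M lborel)"
  shows "(\<lambda>(\<omega>, x). f \<omega> x) \<in> L_space \<alpha> (P \<Otimes>\<^sub>M lborel) \<longleftrightarrow>
    (\<integral>\<^sup>+\<omega>. \<integral>\<^sup>+x. ennreal (\<bar>f \<omega> x\<bar> powr \<alpha>) \<partial>lborel \<partial>P) < \<infinity>"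
proof -
  have "(\<integral>\<^sup>+\<omega>. \<integral>\<^sup>+x. ennreal (\<bar>f \<omega> x\<bar> powr \<alpha>) \<partial>lborel \<partial>P) =
      (\<integral>\<^sup>+p. ennreal (\<bar>(\<lambda>(\<omega>, x). f \<omega> x) p\<bar> powr \<alpha>) \<partial>(P \<Otimes>\<^sub>M lborel))"
    by (subst lborel.nn_integral_fst[symmetric]) auto
  then show ?thesis by (simp add: L_space_def integrable_iff_bounded)
qed

theorem local_time_in_L_space:
  assumes \<alpha>: "0 < \<alpha>" "\<alpha> < 2" and t: "0 \<le> t"
  shows "(\<lambda>(\<omega>, x). l x t \<omega>) \<in> L_space \<alpha> (P \<Otimes>\<^sub>M lborel)"
proof -
  note [measurable] = local_time_measurable[OF t]
  obtain k :: nat where "1 / \<alpha> < real k" using reals_Archimedean2 by blast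
  with \<alpha> have k: "1 \<le> real k * \<alpha>" by (simp add: field_simps)
  have "(\<integral>\<^sup>+\<omega>. \<integral>\<^sup>+x. ennreal (\<bar>l x t \<omega>\<bar> powr \<alpha>) \<partial>lborel \<partial>P) \<le>
    (\<integral>\<^sup>+\<omega>. \<integral>\<^sup>+x. ennreal ((l x t \<omega>)\<^sup>2) + ennreal ((1 + x\<^sup>2) ^ k * l x t \<omega>) + ennreal (inverse (1 + x\<^sup>2)) \<partial>lborel \<partial>P)"
  proof (rule nn_integral_mono_AE, use nonneg in eventually_elim)
    case (elim \<omega>)
    show ?case
    proof (rule nn_integral_mono)
      fix x
      have l0: "0 \<le> l x t \<omega>" using elim t by simp
      have "ennreal (\<bar>l x t \<omega>\<bar> powr \<alpha>) \<le> ennreal ((l x t \<omega>)\<^sup>2 + (1 + x\<^sup>2) ^ k * l x t \<omega> + inverse (1 + x\<^sup>2))"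
        using powr_le_weighted[OF l0 \<alpha> k, of x] l0 by (intro ennreal_leI) simp
      also have "\<dots> = ennreal ((l x t \<omega>)\<^sup>2) + ennreal ((1 + x\<^sup>2) ^ k * l x t \<omega>) + ennreal (inverse (1 + x\<^sup>2))"
        using l0 by (simp add: ennreal_plus)
      finally show "ennreal (\<bar>l x t \<omega>\<bar> powr \<alpha>) \<le> \<dots>" .
    qed
  qed
  also have "\<dots> = (\<integral>\<^sup>+\<omega>. (\<integral>\<^sup>+x. ennreal ((l x t \<omega>)\<^sup>2) \<partial>lborel) + (\<integral>\<^sup>+x. ennreal ((1 + x\<^sup>2) ^ k * l x t \<omega>) \<partial>lborel)
      + (\<integral>\<^sup>+x. ennreal (inverse (1 + x\<^sup>2)) \<partial>lborel) \<partial>P)"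
    by (intro nn_integral_cong) (simp add: nn_integral_add)
  also have "\<dots> = (\<integral>\<^sup>+\<omega>. (\<integral>\<^sup>+x. ennreal ((l x t \<omega>)\<^sup>2) \<partial>lborel) \<partial>P) + (\<integral>\<^sup>+\<omega>. (\<integral>\<^sup>+x. ennreal ((1 + x\<^sup>2) ^ k * l x t \<omega>) \<partial>lborel) \<partial>P)
      + (\<integral>\<^sup>+x. ennreal (inverse (1 + x\<^sup>2)) \<partial>lborel)"
    by (simp add: nn_integral_add emeasure_space_1)
  also have "\<dots> < \<infinity>"
    using local_time_weighted_integral_finite[OF t] local_time_square_integral_finite[OF t]
      nn_integral_inverse_1_plus_square by (simp add: less_top)
  finally show ?thesis by (subst L_space_iff) auto
qed

end

section \<open>Fractional moments of the local time under time shift and time scaling\<close>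

text \<open>The time spent near a level during \<open>[a, t + a]\<close> is a difference of occupation times.\<close>

lemma occupation_average_shift:
  assumes f: "continuous_on {0..} f" and "0 \<le> a" "0 \<le> t"
  shows "occupation_average (\<lambda>s. f (s + a) - b) x t \<epsilon> =
    occupation_average f (x + b) (t + a) \<epsilon> - occupation_average f (x + b) a \<epsilon>"
proof -
  let ?h = "\<lambda>s. tent ((f s - (x + b)) / \<epsilon>)"
  have int: "set_integrable lborel {0..T} ?h" for T by (rule integrable_tent_path[OF f])
  have "(LBINT s:{0..t + a}. ?h s) = (LBINT s:{0..a} \<union> {a..t + a}. ?h s)"
    using assms by (simp add: ivl_disj_un_two_touch)
  also have "\<dots> = (LBINT s:{0..a}. ?h s) + (LBINT s:{a..t + a}. ?h s)"
  proof (rule set_integral_Un_AE)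
    show "AE s in lborel. \<not> (s \<in> {0..a} \<and> s \<in> {a..t + a})"
      using AE_lborel_singleton[of a] by eventually_elim auto
    show "set_integrable lborel {a..t + a} ?h"
      by (rule set_integrable_subset[OF int[of "t + a"]]) (use assms in auto)
  qed (auto intro: int)
  also have "(LBINT s:{a..t + a}. ?h s) = (LBINT s:{0..t}. ?h (s + a))"
  proof -
    have "(\<integral>s. indicator {a..t + a} s *\<^sub>R ?h s \<partial>lborel) =
        \<bar>1\<bar> *\<^sub>R (\<integral>s. indicator {a..t + a} (a + 1 * s) *\<^sub>R ?h (a + 1 * s) \<partial>lborel)"
      by (rule lborel_integral_real_affine) simp
    also have "\<dots> = (\<integral>s. indicator {0..t} s *\<^sub>R ?h (s + a) \<partial>lborel)"
      by (auto simp: indicator_def add.commute intro!: Bochner_Integration.integral_cong)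
    finally show ?thesis by (simp only: set_lebesgue_integral_def)
  qed
  finally have "(LBINT s:{0..t}. ?h (s + a)) = (LBINT s:{0..t + a}. ?h s) - (LBINT s:{0..a}. ?h s)"
    by simp
  then show ?thesis by (simp add: occupation_average_def diff_divide_distrib diff_diff_eq add.commute)
qed

text \<open>The width of the tent is rescaled along with the level, so a tent is turned into a tent.\<close>

lemma occupation_average_rescale:
  assumes c: "0 < c" and d: "0 < d"
  shows "occupation_average (\<lambda>s. inverse d * f (c * s)) x t \<epsilon> =
    d / c * occupation_average f (d * x) (c * t) (d * \<epsilon>)"
proof -
  let ?h = "\<lambda>s. tent ((f s - d * x) / (d * \<epsilon>))"
  have h: "(inverse d * y - x) / \<epsilon> = (y - d * x) / (d * \<epsilon>)" for y
    using d by (simp add: field_simps)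
  have "(\<integral>s. indicator {0..c * t} s *\<^sub>R ?h s \<partial>lborel) =
      \<bar>c\<bar> *\<^sub>R (\<integral>s. indicator {0..c * t} (0 + c * s) *\<^sub>R ?h (0 + c * s) \<partial>lborel)"
    using c by (intro lborel_integral_real_affine) simp
  also have "(\<lambda>s. indicator {0..c * t} (0 + c * s) *\<^sub>R ?h (0 + c * s)) = (\<lambda>s. indicator {0..t} s *\<^sub>R ?h (c * s))"
    using c by (auto simp: indicator_def zero_le_mult_iff)
  finally have "(LBINT s:{0..c * t}. ?h s) = c * (LBINT s:{0..t}. ?h (c * s))"
    using c by (simp add: set_lebesgue_integral_def)
  then show ?thesis
    using c d unfolding occupation_average_def h by simp
qed

lemma nn_integral_law_cong:
  assumes X: "X \<in> borel_measurable P" and X': "X' \<in> borel_measurable P"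
    and law: "distr P borel X = distr P borel X'" and g: "g \<in> borel_measurable borel"
  shows "(\<integral>\<^sup>+\<omega>. g (X \<omega>) \<partial>P) = (\<integral>\<^sup>+\<omega>. g (X' \<omega>) \<partial>P)"
  using nn_integral_distr[OF X, of g] nn_integral_distr[OF X', of g] law g by simp

context fBm_local_time
begin

lemma local_time_of_fBm: "continuous_process_local_time P B l"
  by (rule continuous_process_local_timeI)
    (auto intro: prob_space_axioms measurable_value continuous_paths jointly_continuous_local_time_axioms)

sublocale continuous_process_local_time P B l
  by (rule local_time_of_fBm)

lemma local_time_of_increments:
  assumes a: "0 \<le> a"
  shows "continuous_process_local_time P (\<lambda>t \<omega>. B (t + a) \<omega> - B a \<omega>)
    (\<lambda>x t \<omega>. l (x + B a \<omega>) (t + a) \<omega> - l (x + B a \<omega>) a \<omega>)"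
proof
  note [measurable] = measurable_value[OF a]
  fix t :: real assume t: "0 \<le> t"
  show "(\<lambda>\<omega>. B (t + a) \<omega> - B a \<omega>) \<in> borel_measurable P"
    using a t by (intro borel_measurable_diff measurable_value) auto
  show "(\<lambda>\<omega>. l (x + B a \<omega>) (t + a) \<omega> - l (x + B a \<omega>) a \<omega>) \<in> borel_measurable P" for x
    using a t by (intro borel_measurable_diff local_time_measurable) auto
next
  fix \<omega> assume "\<omega> \<in> space P"
  then show "continuous_on {0..} (\<lambda>t. B (t + a) \<omega> - B a \<omega>)"
    using a by (intro continuous_intros continuous_on_compose2[OF continuous_paths]) auto
next
  show "AE \<omega> in P. \<forall>x. \<forall>t\<ge>0. ((\<lambda>\<epsilon>. occupation_average (\<lambda>s. B (s + a) \<omega> - B a \<omega>) x t \<epsilon>) \<longlongrightarrow>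
      l (x + B a \<omega>) (t + a) \<omega> - l (x + B a \<omega>) a \<omega>) (at_right 0)"
    using averages AE_space
  proof eventually_elim
    case (elim \<omega>)
    show ?case
    proof (intro allI impI)
      fix x t :: real assume t: "0 \<le> t"
      show "((\<lambda>\<epsilon>. occupation_average (\<lambda>s. B (s + a) \<omega> - B a \<omega>) x t \<epsilon>) \<longlongrightarrow>
        l (x + B a \<omega>) (t + a) \<omega> - l (x + B a \<omega>) a \<omega>) (at_right 0)"
        unfolding occupation_average_shift[OF continuous_paths[OF elim(2)] a t]
        using elim(1) a t by (intro tendsto_diff) auto
    qed
  qed
qed

lemma local_time_of_rescaled:
  assumes c: "0 < c"
  shows "continuous_process_local_time P (\<lambda>t \<omega>. c powr (- H) * B (c * t) \<omega>)
    (\<lambda>x t \<omega>. c powr (H - 1) * l (c powr H * x) (c * t) \<omega>)"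
proof
  fix t :: real assume t: "0 \<le> t"
  show "(\<lambda>\<omega>. c powr (- H) * B (c * t) \<omega>) \<in> borel_measurable P"
    using c t by (intro borel_measurable_times measurable_value borel_measurable_const) auto
  show "(\<lambda>\<omega>. c powr (H - 1) * l (c powr H * x) (c * t) \<omega>) \<in> borel_measurable P" for x
    using c t by (intro borel_measurable_times l_measurable borel_measurable_const) auto
next
  fix \<omega> assume "\<omega> \<in> space P"
  then show "continuous_on {0..} (\<lambda>t. c powr (- H) * B (c * t) \<omega>)"
    using c by (intro continuous_intros continuous_on_compose2[OF continuous_paths]) auto
next
  have d: "0 < c powr H" and inv: "c powr (- H) = inverse (c powr H)" and quot: "c powr (H - 1) = c powr H / c"
    using c by (auto simp: powr_minus powr_diff)
  have "filterlim (\<lambda>\<epsilon>. c powr H * \<epsilon>) (at_right 0) (at_right 0)"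
    by (rule filterlim_times_pos[OF filterlim_ident d]) simp
  then have lim: "((\<lambda>\<epsilon>. F (c powr H * \<epsilon>)) \<longlongrightarrow> y) (at_right 0)" if "(F \<longlongrightarrow> y) (at_right 0)" for F and y :: real
    by (rule filterlim_compose[OF that])
  show "AE \<omega> in P. \<forall>x. \<forall>t\<ge>0. ((\<lambda>\<epsilon>. occupation_average (\<lambda>s. c powr (- H) * B (c * s) \<omega>) x t \<epsilon>) \<longlongrightarrow>
      c powr (H - 1) * l (c powr H * x) (c * t) \<omega>) (at_right 0)"
    using averages
  proof eventually_elim
    case (elim \<omega>)
    then show ?case
      unfolding inv quot occupation_average_rescale[OF c d, where f="\<lambda>s. B s \<omega>"]
      using c by (intro allI impI tendsto_mult_left lim) auto
  qed
qed

text \<open>The scale, raised to the power \<open>\<alpha>\<close>, of the stable variable \<open>\<Sum> c\<^sub>t Y(t)\<close>.\<close>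

definition moment :: "real \<Rightarrow> real set \<Rightarrow> (real \<Rightarrow> real) \<Rightarrow> ennreal" where
  "moment \<alpha> J c = (\<integral>\<^sup>+\<omega>. \<integral>\<^sup>+x. ennreal (\<bar>\<Sum>t\<in>J. c t * l x t \<omega>\<bar> powr \<alpha>) \<partial>lborel \<partial>P)"

lemma moment_swap:
  assumes J: "J \<subseteq> {0..}"
  shows "moment \<alpha> J c = (\<integral>\<^sup>+x. \<integral>\<^sup>+\<omega>. ennreal (\<bar>\<Sum>t\<in>J. c t * l x t \<omega>\<bar> powr \<alpha>) \<partial>P \<partial>lborel)"
proof -
  interpret PL: pair_sigma_finite P lborel by unfold_locales
  have [measurable]: "(\<lambda>p. l (snd p) t (fst p)) \<in> borel_measurable (P \<Otimes>\<^sub>M lborel)" if "t \<in> J" for t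
    using that J by (intro local_time_measurable) auto
  show ?thesis
    unfolding moment_def by (rule PL.Fubini'[symmetric]) (simp add: case_prod_beta')
qed

text \<open>Translating the level by the random amount \<open>B(a)\<close> does not change the integral over the levels and
  turns the integrand into a combination of local times of the process \<open>B(t+a) - B(a)\<close>, for which each
  level can be treated separately.\<close>

lemma moment_increments:
  assumes J: "finite J" "J \<subseteq> {0..}" and a: "0 \<le> a"
  shows "(\<integral>\<^sup>+\<omega>. \<integral>\<^sup>+x. ennreal (\<bar>\<Sum>t\<in>J. c t * (l x (t + a) \<omega> - l x a \<omega>)\<bar> powr \<alpha>) \<partial>lborel \<partial>P) = moment \<alpha> J c"
proof -
  interpret PL: pair_sigma_finite P lborel by unfold_locales
  interpret inc: continuous_process_local_time P "\<lambda>t \<omega>. B (t + a) \<omega> - B a \<omega>"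
    "\<lambda>x t \<omega>. l (x + B a \<omega>) (t + a) \<omega> - l (x + B a \<omega>) a \<omega>"
    by (rule local_time_of_increments[OF a])
  note [measurable] = measurable_value[OF a]
  let ?g = "\<lambda>y :: real. ennreal (\<bar>y\<bar> powr \<alpha>)"
  let ?k = "\<lambda>\<omega> x t. l x (t + a) \<omega> - l x a \<omega>"
  have k[measurable]: "(\<lambda>p. ?k (fst p) (f p) t) \<in> borel_measurable (P \<Otimes>\<^sub>M lborel)"
    if "t \<in> J" "f \<in> borel_measurable (P \<Otimes>\<^sub>M lborel)" for t f
    using that J a by (intro borel_measurable_diff local_time_measurable) auto
  have joint: "(\<lambda>(\<omega>, x). ?g (\<Sum>t\<in>J. c t * ?k \<omega> (x + B a \<omega>) t)) \<in> borel_measurable (P \<Otimes>\<^sub>M lborel)"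
  proof -
    have "(\<lambda>p. \<Sum>t\<in>J. c t * ?k (fst p) (snd p + B a (fst p)) t) \<in> borel_measurable (P \<Otimes>\<^sub>M lborel)"
      by (intro borel_measurable_sum borel_measurable_times[OF borel_measurable_const] k) measurable
    moreover have "?g \<in> borel_measurable borel" by measurable
    ultimately show ?thesis unfolding case_prod_beta' by (rule measurable_compose)
  qed
  have k1[measurable]: "(\<lambda>x. ?k \<omega> x t) \<in> borel_measurable borel" if "\<omega> \<in> space P" "t \<in> J" for \<omega> t
    using that J a by (intro borel_measurable_diff local_time_measurable) auto
  have "(\<integral>\<^sup>+\<omega>. \<integral>\<^sup>+x. ?g (\<Sum>t\<in>J. c t * ?k \<omega> x t) \<partial>lborel \<partial>P) =
      (\<integral>\<^sup>+\<omega>. \<integral>\<^sup>+x. ?g (\<Sum>t\<in>J. c t * ?k \<omega> (x + B a \<omega>) t) \<partial>lborel \<partial>P)"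
  proof (rule nn_integral_cong)
    fix \<omega> assume "\<omega> \<in> space P"
    note [measurable] = k1[OF this]
    show "(\<integral>\<^sup>+x. ?g (\<Sum>t\<in>J. c t * ?k \<omega> x t) \<partial>lborel) = (\<integral>\<^sup>+x. ?g (\<Sum>t\<in>J. c t * ?k \<omega> (x + B a \<omega>) t) \<partial>lborel)"
      using nn_integral_real_affine[of "\<lambda>x. ?g (\<Sum>t\<in>J. c t * ?k \<omega> x t)" 1 "B a \<omega>"]
      by (simp add: add.commute)
  qed
  also have "\<dots> = (\<integral>\<^sup>+x. \<integral>\<^sup>+\<omega>. ?g (\<Sum>t\<in>J. c t * ?k \<omega> (x + B a \<omega>) t) \<partial>P \<partial>lborel)"
    by (rule PL.Fubini'[symmetric]) (rule joint)
  also have "\<dots> = (\<integral>\<^sup>+x. \<integral>\<^sup>+\<omega>. ?g (\<Sum>t\<in>J. c t * l x t \<omega>) \<partial>P \<partial>lborel)"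
  proof (rule nn_integral_cong)
    fix x
    have "(\<lambda>\<omega>. \<Sum>t\<in>J. c t * (?k \<omega> (x + B a \<omega>) t)) \<in> borel_measurable P"
      using J by (intro borel_measurable_sum borel_measurable_times[OF borel_measurable_const] inc.l_measurable) auto
    moreover have "(\<lambda>\<omega>. \<Sum>t\<in>J. c t * l x t \<omega>) \<in> borel_measurable P"
      using J by (intro borel_measurable_sum borel_measurable_times[OF borel_measurable_const] l_measurable) auto
    ultimately show "(\<integral>\<^sup>+\<omega>. ?g (\<Sum>t\<in>J. c t * (?k \<omega> (x + B a \<omega>) t)) \<partial>P) = (\<integral>\<^sup>+\<omega>. ?g (\<Sum>t\<in>J. c t * l x t \<omega>) \<partial>P)"
      by (rule nn_integral_law_cong)
        (rule local_time_law_cong[OF inc.continuous_process_local_time_axioms local_time_of_fBm increments_same_fdd[OF a] J], measurable)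
  qed
  also have "\<dots> = moment \<alpha> J c" by (rule moment_swap[symmetric]) fact
  finally show ?thesis .
qed

text \<open>The substitution of the level by \<open>r\<^sup>H x\<close> contributes \<open>r\<^sup>H\<close>; the remaining power of \<open>r\<close> compensates the factor
  \<open>r powr (H - 1)\<close> in the local time of the rescaled process.\<close>

lemma moment_rescaled:
  assumes J: "finite J" "J \<subseteq> {0..}" and r: "0 < r"
  shows "(\<integral>\<^sup>+\<omega>. \<integral>\<^sup>+x. ennreal (\<bar>\<Sum>t\<in>J. c t * l x (r * t) \<omega>\<bar> powr \<alpha>) \<partial>lborel \<partial>P) =
    ennreal (r powr (H + (1 - H) * \<alpha>)) * moment \<alpha> J c"
proof -
  interpret PL: pair_sigma_finite P lborel by unfold_locales
  let ?d = "r powr H"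
  let ?g = "\<lambda>y :: real. ennreal (\<bar>y\<bar> powr \<alpha>)"
  let ?k = "\<lambda>\<omega> x t. r powr (H - 1) * l (?d * x) (r * t) \<omega>"
  interpret res: continuous_process_local_time P "\<lambda>t \<omega>. r powr (- H) * B (r * t) \<omega>" "\<lambda>x t \<omega>. ?k \<omega> x t"
    by (rule local_time_of_rescaled[OF r])
  have d: "0 < ?d" using r by simp
  have k[measurable]: "(\<lambda>p. ?k (fst p) (snd p) t) \<in> borel_measurable (P \<Otimes>\<^sub>M lborel)" if "t \<in> J" for t
    using that J r by (intro borel_measurable_times local_time_measurable) auto
  have joint: "(\<lambda>(\<omega>, x). ?g (\<Sum>t\<in>J. c t * ?k \<omega> x t)) \<in> borel_measurable (P \<Otimes>\<^sub>M lborel)"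
  proof -
    have "(\<lambda>p. \<Sum>t\<in>J. c t * ?k (fst p) (snd p) t) \<in> borel_measurable (P \<Otimes>\<^sub>M lborel)"
      by (intro borel_measurable_sum borel_measurable_times[OF borel_measurable_const] k) 
    moreover have "?g \<in> borel_measurable borel" by measurable
    ultimately show ?thesis unfolding case_prod_beta' by (rule measurable_compose)
  qed
  have k1[measurable]: "(\<lambda>x. l x (r * t) \<omega>) \<in> borel_measurable borel" if "\<omega> \<in> space P" "t \<in> J" for \<omega> t
    using that J r by (intro local_time_measurable) auto
  have "(\<integral>\<^sup>+\<omega>. \<integral>\<^sup>+x. ?g (\<Sum>t\<in>J. c t * l x (r * t) \<omega>) \<partial>lborel \<partial>P) =
      (\<integral>\<^sup>+\<omega>. ennreal (r powr (H + (1 - H) * \<alpha>)) * (\<integral>\<^sup>+x. ?g (\<Sum>t\<in>J. c t * ?k \<omega> x t) \<partial>lborel) \<partial>P)"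
  proof (rule nn_integral_cong)
    fix \<omega> assume \<omega>: "\<omega> \<in> space P"
    note [measurable] = k1[OF \<omega>]
    have scale: "?g (\<Sum>t\<in>J. c t * l (?d * x) (r * t) \<omega>) = ennreal (r powr ((1 - H) * \<alpha>)) * ?g (\<Sum>t\<in>J. c t * ?k \<omega> x t)" for x
    proof -
      have "(\<Sum>t\<in>J. c t * ?k \<omega> x t) = r powr (H - 1) * (\<Sum>t\<in>J. c t * l (?d * x) (r * t) \<omega>)"
        by (simp add: sum_distrib_left mult_ac)
      then have "\<bar>\<Sum>t\<in>J. c t * ?k \<omega> x t\<bar> powr \<alpha> = r powr ((H - 1) * \<alpha>) * \<bar>\<Sum>t\<in>J. c t * l (?d * x) (r * t) \<omega>\<bar> powr \<alpha>"
        by (simp add: abs_mult powr_mult powr_powr)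
      moreover have "r powr ((1 - H) * \<alpha>) * r powr ((H - 1) * \<alpha>) = 1"
        using r by (simp add: left_diff_distrib flip: powr_add)
      ultimately show ?thesis
        by (simp add: ennreal_mult[symmetric] mult.assoc[symmetric])
    qed
    have "(\<integral>\<^sup>+x. ?g (\<Sum>t\<in>J. c t * l x (r * t) \<omega>) \<partial>lborel) = ennreal ?d * (\<integral>\<^sup>+x. ?g (\<Sum>t\<in>J. c t * l (?d * x) (r * t) \<omega>) \<partial>lborel)"
      using nn_integral_real_affine[of "\<lambda>x. ?g (\<Sum>t\<in>J. c t * l x (r * t) \<omega>)" ?d 0] d by simp
    also have "\<dots> = ennreal ?d * (ennreal (r powr ((1 - H) * \<alpha>)) * (\<integral>\<^sup>+x. ?g (\<Sum>t\<in>J. c t * ?k \<omega> x t) \<partial>lborel))"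
      unfolding scale by (subst nn_integral_cmult) auto
    also have "\<dots> = ennreal (r powr (H + (1 - H) * \<alpha>)) * (\<integral>\<^sup>+x. ?g (\<Sum>t\<in>J. c t * ?k \<omega> x t) \<partial>lborel)"
      by (simp add: powr_add ennreal_mult mult.assoc)
    finally show "(\<integral>\<^sup>+x. ?g (\<Sum>t\<in>J. c t * l x (r * t) \<omega>) \<partial>lborel) = \<dots>" .
  qed
  also have "\<dots> = ennreal (r powr (H + (1 - H) * \<alpha>)) * (\<integral>\<^sup>+\<omega>. \<integral>\<^sup>+x. ?g (\<Sum>t\<in>J. c t * ?k \<omega> x t) \<partial>lborel \<partial>P)"
    by (rule nn_integral_cmult) (rule lborel.borel_measurable_nn_integral[OF joint])
  also have "(\<integral>\<^sup>+\<omega>. \<integral>\<^sup>+x. ?g (\<Sum>t\<in>J. c t * ?k \<omega> x t) \<partial>lborel \<partial>P) = (\<integral>\<^sup>+x. \<integral>\<^sup>+\<omega>. ?g (\<Sum>t\<in>J. c t * ?k \<omega> x t) \<partial>P \<partial>lborel)"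
    by (rule PL.Fubini'[symmetric]) (rule joint)
  also have "\<dots> = (\<integral>\<^sup>+x. \<integral>\<^sup>+\<omega>. ?g (\<Sum>t\<in>J. c t * l x t \<omega>) \<partial>P \<partial>lborel)"
  proof (rule nn_integral_cong)
    fix x
    have "(\<lambda>\<omega>. \<Sum>t\<in>J. c t * (?k \<omega> x t)) \<in> borel_measurable P"
      using J by (intro borel_measurable_sum borel_measurable_times[OF borel_measurable_const] res.l_measurable) auto
    moreover have "(\<lambda>\<omega>. \<Sum>t\<in>J. c t * l x t \<omega>) \<in> borel_measurable P"
      using J by (intro borel_measurable_sum borel_measurable_times[OF borel_measurable_const] l_measurable) auto
    ultimately show "(\<integral>\<^sup>+\<omega>. ?g (\<Sum>t\<in>J. c t * (?k \<omega> x t)) \<partial>P) = (\<integral>\<^sup>+\<omega>. ?g (\<Sum>t\<in>J. c t * l x t \<omega>) \<partial>P)"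
      by (rule nn_integral_law_cong)
        (rule local_time_law_cong[OF res.continuous_process_local_time_axioms local_time_of_fBm rescaled_same_fdd[OF r] J], measurable)
  qed
  also have "\<dots> = moment \<alpha> J c" by (rule moment_swap[symmetric]) fact
  finally show ?thesis .
qed

end

section \<open>Stable integrals and the invariances of Y\<close>

lemma abs_add_powr_le:
  fixes u v \<alpha> :: real
  assumes "0 \<le> \<alpha>"
  shows "\<bar>u + v\<bar> powr \<alpha> \<le> 2 powr \<alpha> * (\<bar>u\<bar> powr \<alpha> + \<bar>v\<bar> powr \<alpha>)"
proof -
  have "\<bar>u + v\<bar> powr \<alpha> \<le> (2 * max \<bar>u\<bar> \<bar>v\<bar>) powr \<alpha>"
    using assms by (intro powr_mono2) auto
  also have "\<dots> = 2 powr \<alpha> * max \<bar>u\<bar> \<bar>v\<bar> powr \<alpha>" by (simp add: powr_mult)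
  also have "\<dots> \<le> 2 powr \<alpha> * (\<bar>u\<bar> powr \<alpha> + \<bar>v\<bar> powr \<alpha>)"
    by (intro mult_left_mono) (auto simp: max_def)
  finally show ?thesis .
qed

lemma L_space_measurable: "f \<in> L_space \<alpha> m \<Longrightarrow> f \<in> borel_measurable m"
  by (simp add: L_space_def)

lemma L_space_zero: "(\<lambda>_. 0) \<in> L_space \<alpha> m"
  by (simp add: L_space_def)

lemma L_space_linear:
  assumes \<alpha>: "0 \<le> \<alpha>" and f: "f \<in> L_space \<alpha> m" and g: "g \<in> L_space \<alpha> m"
  shows "(\<lambda>x. a * f x + b * g x) \<in> L_space \<alpha> m"
proof -
  note [measurable] = L_space_measurable[OF f] L_space_measurable[OF g]
  have dom: "integrable m (\<lambda>x. 2 powr \<alpha> * (\<bar>a\<bar> powr \<alpha> * \<bar>f x\<bar> powr \<alpha> + \<bar>b\<bar> powr \<alpha> * \<bar>g x\<bar> powr \<alpha>))"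
    using f g by (simp add: L_space_def)
  have bound: "\<bar>a * f x + b * g x\<bar> powr \<alpha> \<le> 2 powr \<alpha> * (\<bar>a\<bar> powr \<alpha> * \<bar>f x\<bar> powr \<alpha> + \<bar>b\<bar> powr \<alpha> * \<bar>g x\<bar> powr \<alpha>)" for x
    using abs_add_powr_le[OF \<alpha>, of "a * f x" "b * g x"] by (simp add: abs_mult powr_mult)
  from dom have "integrable m (\<lambda>x. \<bar>a * f x + b * g x\<bar> powr \<alpha>)"
    by (rule Bochner_Integration.integrable_bound) (use bound in auto)
  then show ?thesis by (simp add: L_space_def)
qed

context SaS_random_measure
begin

lemma integral_zero: "AE \<omega> in P. I (\<lambda>_. 0) \<omega> = 0"
  using integral_linear[OF L_space_zero L_space_zero, of 0 0] by simp

lemma L_space_sum: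
  assumes "0 \<le> \<alpha>" and "finite J" and "\<And>j. j \<in> J \<Longrightarrow> f j \<in> L_space \<alpha> m"
  shows "(\<lambda>x. \<Sum>j\<in>J. c j * f j x) \<in> L_space \<alpha> m"
  using assms(2,3)
proof (induction J rule: finite_induct)
  case (insert j J)
  then have "(\<lambda>x. c j * f j x + 1 * (\<Sum>j\<in>J. c j * f j x)) \<in> L_space \<alpha> m"
    by (intro L_space_linear assms(1)) auto
  with insert.hyps show ?case by simp
qed (simp add: L_space_zero)

lemma integral_sum:
  assumes "0 \<le> \<alpha>" and "finite J" and "\<And>j. j \<in> J \<Longrightarrow> f j \<in> L_space \<alpha> m"
  shows "AE \<omega> in P. I (\<lambda>x. \<Sum>j\<in>J. c j * f j x) \<omega> = (\<Sum>j\<in>J. c j * I (f j) \<omega>)"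
  using assms(2,3)
proof (induction J rule: finite_induct)
  case empty
  show ?case using integral_zero by simp
next
  case (insert j J)
  have "AE \<omega> in P. I (\<lambda>x. c j * f j x + 1 * (\<Sum>j\<in>J. c j * f j x)) \<omega> =
      c j * I (f j) \<omega> + 1 * I (\<lambda>x. \<Sum>j\<in>J. c j * f j x) \<omega>"
    using insert.hyps insert.prems by (intro integral_linear L_space_sum assms(1)) auto
  moreover have "AE \<omega> in P. I (\<lambda>x. \<Sum>j\<in>J. c j * f j x) \<omega> = (\<Sum>j\<in>J. c j * I (f j) \<omega>)"
    using insert by auto
  ultimately show ?case
    by eventually_elim (use insert.hyps in simp)
qed

text \<open>Linearity holds almost surely for each pair of integrands, hence for finite combinations, and
  the transform is not affected by the exceptional null sets.\<close>

lemma char_combination: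
  assumes \<alpha>: "0 \<le> \<alpha>" and J: "finite J" and f: "\<And>j. j \<in> J \<Longrightarrow> f j \<in> L_space \<alpha> m"
    and Z: "\<And>j. j \<in> J \<Longrightarrow> Z j \<in> borel_measurable P" "\<And>j. j \<in> J \<Longrightarrow> AE \<omega> in P. Z j \<omega> = I (f j) \<omega>"
  shows "(CLINT \<omega>|P. iexp (\<theta> * (\<Sum>j\<in>J. c j * Z j \<omega>))) =
    of_real (exp (- (\<bar>\<theta>\<bar> powr \<alpha> * (\<integral>x. \<bar>\<Sum>j\<in>J. c j * f j x\<bar> powr \<alpha> \<partial>m))))"
proof -
  let ?F = "\<lambda>x. \<Sum>j\<in>J. c j * f j x"
  have F: "?F \<in> L_space \<alpha> m" by (rule L_space_sum[OF \<alpha> J f])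
  note [measurable] = integral_measurable[OF F]
  have ZS[measurable]: "(\<lambda>\<omega>. \<Sum>j\<in>J. c j * Z j \<omega>) \<in> borel_measurable P"
    using Z(1) by (intro borel_measurable_sum borel_measurable_times[OF borel_measurable_const])
  have "AE \<omega> in P. \<forall>j\<in>J. Z j \<omega> = I (f j) \<omega>"
    using J Z(2) by (simp add: AE_finite_all)
  moreover have "AE \<omega> in P. I ?F \<omega> = (\<Sum>j\<in>J. c j * I (f j) \<omega>)"
    by (rule integral_sum[OF \<alpha> J f])
  ultimately have "AE \<omega> in P. (\<Sum>j\<in>J. c j * Z j \<omega>) = I ?F \<omega>"
    by eventually_elim simp
  then have "AE \<omega> in P. iexp (\<theta> * (\<Sum>j\<in>J. c j * Z j \<omega>)) = iexp (\<theta> * I ?F \<omega>)"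
    by eventually_elim (simp only:)
  then have "(CLINT \<omega>|P. iexp (\<theta> * (\<Sum>j\<in>J. c j * Z j \<omega>))) = (CLINT \<omega>|P. iexp (\<theta> * I ?F \<omega>))"
    using Z(1) by (intro integral_cong_AE) measurable
  also have "\<dots> = char (distr P borel (I ?F)) \<theta>"
    by (simp add: char_def integral_distr)
  finally show ?thesis using integral_char[OF F] by simp
qed

end

theorem theorem3p1:
  fixes \<alpha> H :: real
    and P' :: "'w measure" and B :: "real \<Rightarrow> 'w \<Rightarrow> real" and l :: "real \<Rightarrow> real \<Rightarrow> 'w \<Rightarrow> real"
    and P :: "'v measure" and M :: "('w \<times> real) set \<Rightarrow> 'v \<Rightarrow> real"
    and I :: "('w \<times> real \<Rightarrow> real) \<Rightarrow> 'v \<Rightarrow> real"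
    and Y :: "real \<Rightarrow> 'v \<Rightarrow> real"
  assumes "0 < \<alpha>" and "\<alpha> < 2" and "0 < H" and "H < 1"
    and "fractional_Brownian_motion P' H B"
    and "jointly_continuous_local_time P' B l"
    and "SaS_random_measure P (P' \<Otimes>\<^sub>M lborel) \<alpha> M I"
    and "\<And>t. 0 \<le> t \<Longrightarrow> Y t = I (\<lambda>(\<omega>', x). l x t \<omega>')"
  shows "(\<forall>t\<ge>0. (\<lambda>(\<omega>', x). l x t \<omega>') \<in> L_space \<alpha> (P' \<Otimes>\<^sub>M lborel)) \<and>
    SaS_process P \<alpha> Y \<and>
    stationary_increments P Y \<and>
    self_similar P (1 - H + H / \<alpha>) Y \<and>
    1 - H + H / \<alpha> = 1 + H * (1 / \<alpha> - 1)"
proof -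
  interpret fractional_Brownian_motion P' H B by fact
  interpret jointly_continuous_local_time P' B l by fact
  interpret fBm_local_time P' H B l by unfold_locales
  interpret S: SaS_random_measure P "P' \<Otimes>\<^sub>M lborel" \<alpha> M I by fact
  note Y = assms(8)
  have \<alpha>: "0 \<le> \<alpha>" using assms(1) by simp
  define k where "k t = (\<lambda>(\<omega>' :: 'w, x). l x t \<omega>')" for t
  have k: "k t \<in> L_space \<alpha> (P' \<Otimes>\<^sub>M lborel)" if "0 \<le> t" for t
    unfolding k_def by (rule local_time_in_L_space[OF assms(1,2) that])
  have Yk: "Y t = I (k t)" if "0 \<le> t" for t using Y[OF that] by (simp add: k_def)
  have Ym: "Y t \<in> borel_measurable P" if "0 \<le> t" for t
    using S.integral_measurable[OF k[OF that]] by (simp add: Yk[OF that])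
  have scale: "(\<integral>p. \<bar>F p\<bar> powr \<alpha> \<partial>(P' \<Otimes>\<^sub>M lborel)) =
      enn2real (\<integral>\<^sup>+\<omega>'. \<integral>\<^sup>+x. ennreal (\<bar>F (\<omega>', x)\<bar> powr \<alpha>) \<partial>lborel \<partial>P')"
    if F: "F \<in> L_space \<alpha> (P' \<Otimes>\<^sub>M lborel)" for F
  proof -
    note [measurable] = L_space_measurable[OF F]
    have "(\<integral>p. \<bar>F p\<bar> powr \<alpha> \<partial>(P' \<Otimes>\<^sub>M lborel)) = enn2real (\<integral>\<^sup>+p. ennreal (\<bar>F p\<bar> powr \<alpha>) \<partial>(P' \<Otimes>\<^sub>M lborel))"
      by (rule integral_eq_nn_integral) auto
    also have "(\<integral>\<^sup>+p. ennreal (\<bar>F p\<bar> powr \<alpha>) \<partial>(P' \<Otimes>\<^sub>M lborel)) =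
        (\<integral>\<^sup>+\<omega>'. \<integral>\<^sup>+x. ennreal (\<bar>F (\<omega>', x)\<bar> powr \<alpha>) \<partial>lborel \<partial>P')"
      by (rule lborel.nn_integral_fst[symmetric]) measurable
    finally show ?thesis .
  qed
  have "SaS_process P \<alpha> Y"
    unfolding SaS_process_def
  proof safe
    fix J :: "real set" and c :: "real \<Rightarrow> real" assume J: "finite J" "J \<subseteq> {0..}"
    let ?s = "\<integral>p. \<bar>\<Sum>t\<in>J. c t * k t p\<bar> powr \<alpha> \<partial>(P' \<Otimes>\<^sub>M lborel)"
    have meas: "(\<lambda>\<omega>. \<Sum>t\<in>J. c t * Y t \<omega>) \<in> borel_measurable P"
      using J by (intro borel_measurable_sum borel_measurable_times[OF borel_measurable_const] Ym) auto
    have "char (distr P borel (\<lambda>\<omega>. \<Sum>t\<in>J. c t * Y t \<omega>)) \<theta> = of_real (exp (- (\<bar>\<theta>\<bar> powr \<alpha> * ?s)))" for \<theta>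
    proof -
      have "char (distr P borel (\<lambda>\<omega>. \<Sum>t\<in>J. c t * Y t \<omega>)) \<theta> = (CLINT \<omega>|P. iexp (\<theta> * (\<Sum>t\<in>J. c t * Y t \<omega>)))"
        unfolding char_def by (rule integral_distr[OF meas]) measurable
      also have "\<dots> = of_real (exp (- (\<bar>\<theta>\<bar> powr \<alpha> * ?s)))"
        by (rule S.char_combination[OF \<alpha> J(1)]) (use J k Ym Yk in auto)
      finally show ?thesis .
    qed
    moreover have "(?s powr (1 / \<alpha>)) powr \<alpha> = ?s"
      using assms(1) by (simp add: powr_powr)
    ultimately show "SaS_rv P \<alpha> (\<lambda>\<omega>. \<Sum>t\<in>J. c t * Y t \<omega>)"
      unfolding SaS_rv_def using meas by (intro conjI exI[of _ "?s powr (1 / \<alpha>)"]) (auto simp: mult.commute)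
  qed
  moreover have "stationary_increments P Y"
  proof -
    have char_inc: "(CLINT \<omega>|P. iexp (\<Sum>t\<in>J. c t * (Y (t + a) \<omega> - Y a \<omega>))) = of_real (exp (- enn2real (moment \<alpha> J c)))"
      if J: "finite J" "J \<subseteq> {0..}" and a: "0 \<le> a" for J c a
    proof -
      define f where "f t = (\<lambda>p. 1 * k (t + a) p + (- 1) * k a p)" for t
      have f: "f t \<in> L_space \<alpha> (P' \<Otimes>\<^sub>M lborel)" if "t \<in> J" for t
        unfolding f_def using that J a by (intro L_space_linear \<alpha> k) auto
      have "(CLINT \<omega>|P. iexp (1 * (\<Sum>t\<in>J. c t * (Y (t + a) \<omega> - Y a \<omega>)))) =
          of_real (exp (- (\<bar>1\<bar> powr \<alpha> * (\<integral>p. \<bar>\<Sum>t\<in>J. c t * f t p\<bar> powr \<alpha> \<partial>(P' \<Otimes>\<^sub>M lborel)))))"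
      proof (rule S.char_combination[OF \<alpha> J(1) f])
        fix t assume t: "t \<in> J"
        show "(\<lambda>\<omega>. Y (t + a) \<omega> - Y a \<omega>) \<in> borel_measurable P"
          using t J a by (intro borel_measurable_diff Ym) auto
        have "AE \<omega> in P. I (f t) \<omega> = 1 * I (k (t + a)) \<omega> + (- 1) * I (k a) \<omega>"
          unfolding f_def using t J a by (intro S.integral_linear k) auto
        then show "AE \<omega> in P. Y (t + a) \<omega> - Y a \<omega> = I (f t) \<omega>"
          using t J a by (auto simp: Yk subset_eq)
      qed
      also have "(\<integral>p. \<bar>\<Sum>t\<in>J. c t * f t p\<bar> powr \<alpha> \<partial>(P' \<Otimes>\<^sub>M lborel)) = enn2real (moment \<alpha> J c)"
        using moment_increments[OF J a, where \<alpha>=\<alpha> and c=c]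
        by (subst scale[OF S.L_space_sum[OF \<alpha> J(1) f]]) (auto simp: f_def k_def)
      finally show ?thesis by simp
    qed
    show ?thesis
      unfolding stationary_increments_def
    proof (intro allI impI same_fddI_char S.prob_space_axioms)
      fix a b :: real and J :: "real set" and c :: "real \<Rightarrow> real"
      assume "0 \<le> a" "0 \<le> b" "finite J" "J \<subseteq> {0..}"
      then show "(CLINT \<omega>|P. iexp (\<Sum>t\<in>J. c t * (Y (t + a) \<omega> - Y a \<omega>))) =
          (CLINT \<omega>|P. iexp (\<Sum>t\<in>J. c t * (Y (t + b) \<omega> - Y b \<omega>)))"
        by (simp only: char_inc)
    qed (auto intro!: borel_measurable_diff Ym)
  qed
  moreover have "self_similar P (1 - H + H / \<alpha>) Y"
    unfolding self_similar_def
  proof (intro allI impI same_fddI_char S.prob_space_axioms)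
    fix r :: real and J :: "real set" and c :: "real \<Rightarrow> real" assume r: "0 < r" and J: "finite J" "J \<subseteq> {0..}"
    let ?h = "1 - H + H / \<alpha>"
    have h\<alpha>: "H + (1 - H) * \<alpha> = ?h * \<alpha>" using assms(1) by (simp add: field_simps)
    have "(CLINT \<omega>|P. iexp (1 * (\<Sum>t\<in>J. c t * Y (r * t) \<omega>))) =
        of_real (exp (- (\<bar>1\<bar> powr \<alpha> * (\<integral>p. \<bar>\<Sum>t\<in>J. c t * k (r * t) p\<bar> powr \<alpha> \<partial>(P' \<Otimes>\<^sub>M lborel)))))"
      by (rule S.char_combination[OF \<alpha> J(1)]) (use J r k Ym Yk in \<open>auto simp: subset_eq\<close>)
    also have "(\<integral>p. \<bar>\<Sum>t\<in>J. c t * k (r * t) p\<bar> powr \<alpha> \<partial>(P' \<Otimes>\<^sub>M lborel)) = r powr (?h * \<alpha>) * enn2real (moment \<alpha> J c)"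
      using moment_rescaled[OF J r, where \<alpha>=\<alpha> and c=c] J r k
      by (subst scale[OF S.L_space_sum[OF \<alpha> J(1)]]) (auto simp: k_def enn2real_mult h\<alpha> subset_eq)
    finally have lhs: "(CLINT \<omega>|P. iexp (\<Sum>t\<in>J. c t * Y (r * t) \<omega>)) = of_real (exp (- (r powr (?h * \<alpha>) * enn2real (moment \<alpha> J c))))"
      by simp
    have "(CLINT \<omega>|P. iexp (r powr ?h * (\<Sum>t\<in>J. c t * Y t \<omega>))) =
        of_real (exp (- (\<bar>r powr ?h\<bar> powr \<alpha> * (\<integral>p. \<bar>\<Sum>t\<in>J. c t * k t p\<bar> powr \<alpha> \<partial>(P' \<Otimes>\<^sub>M lborel)))))"
      by (rule S.char_combination[OF \<alpha> J(1)]) (use J k Ym Yk in \<open>auto simp: subset_eq\<close>)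
    also have "(\<integral>p. \<bar>\<Sum>t\<in>J. c t * k t p\<bar> powr \<alpha> \<partial>(P' \<Otimes>\<^sub>M lborel)) = enn2real (moment \<alpha> J c)"
      using J k by (subst scale[OF S.L_space_sum[OF \<alpha> J(1)]]) (auto simp: k_def moment_def subset_eq)
    finally have "(CLINT \<omega>|P. iexp (r powr ?h * (\<Sum>t\<in>J. c t * Y t \<omega>))) = of_real (exp (- (r powr (?h * \<alpha>) * enn2real (moment \<alpha> J c))))"
      by (simp only: abs_of_nonneg[OF powr_ge_zero] powr_powr)
    moreover have "r powr ?h * (\<Sum>t\<in>J. c t * Y t \<omega>) = (\<Sum>t\<in>J. c t * (r powr ?h * Y t \<omega>))" for \<omega>
      unfolding sum_distrib_left by (intro sum.cong refl mult.left_commute)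
    ultimately show "(CLINT \<omega>|P. iexp (\<Sum>t\<in>J. c t * Y (r * t) \<omega>)) =
        (CLINT \<omega>|P. iexp (\<Sum>t\<in>J. c t * (r powr ?h * Y t \<omega>)))"
      by (simp only: lhs)
  qed ((rule Ym borel_measurable_times[OF borel_measurable_const Ym]; auto)+)
  moreover have "1 - H + H / \<alpha> = 1 + H * (1 / \<alpha> - 1)" by (simp add: algebra_simps)
  ultimately show ?thesis using k unfolding k_def by blast
qed

end
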